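(* Let $G=\mathbb{Z}/p\mathbb{Z}$ with $p\geq 2$ a prime, and let $A,B\subseteq G$ be nonempty subsets with $A+B\neq G$. Set $C=-\,(G\setminus(A+B))$. Suppose $|A|\geq|B|$, $|A\cup B|\leq \lceil \log_2 p\rceil$, and, defining the integer $r$ by $|A+B|=|A|+|B|+r$, $$|A+B|=|A|+|B|+r\leq |A|+2|B|-3-\delta,$$ where $\delta=1$ if $A$ and $B$ are translates of each other and $\delta=0$ otherwise. Then there are arithmetic progressions $P_A,P_B,P_C\subseteq G$, all having a common difference, such that $X\subseteq P_X$ and $|P_X|\leq |X|+r+1$ for all $X\in\{A,B,C\}$.
   Context: An arithmetic progression in $G$ with difference $d$ is a set $\{a,a+d,\dots,a+(n-1)d\}$ with $a\in G$, $n\ge1$. *)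

theory Defs
  imports Complex_Main "HOL-Number_Theory.Residues"
begin

(* The progression is a set, so repetitions are allowed: for d = 0 it is a singleton, and for n
   larger than the order of d it is a coset of the subgroup generated by d. *)
definition arith_prog :: "('a, 'm) ring_scheme \<Rightarrow> 'a \<Rightarrow> 'a set \<Rightarrow> bool" where
  "arith_prog G d P \<longleftrightarrow>
     d \<in> carrier G \<and>
     (\<exists>a\<in>carrier G. \<exists>n::nat. n \<ge> 1 \<and> P = {a \<oplus>\<^bsub>G\<^esub> [i] \<cdot>\<^bsub>G\<^esub> d | i::nat. i < n})"

definition are_translates :: "('a, 'm) ring_scheme \<Rightarrow> 'a set \<Rightarrow> 'a set \<Rightarrow> bool" where
  "are_translates G A B \<longleftrightarrow> (\<exists>x\<in>carrier G. B = A +>\<^bsub>G\<^esub> x)"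

end

theory Submission
  imports Defs "HOL-Library.Set_Algebras" "Jordan_Normal_Form.Determinant"
begin

text \<open>
  The size condition makes \<open>A \<union> B\<close> rectifiable: the relations \<open>a + b = c + d\<close> that hold modulo \<open>p\<close>
  form a linear system whose minors are smaller than \<open>p\<close>, so the tautological solution modulo \<open>p\<close> lifts to
  an integer solution. The lift is a Freiman isomorphism inverted by reduction modulo \<open>p\<close>, and arithmetic
  progressions found in the integers can be reduced modulo \<open>p\<close>.

  For integer sets, normalized to have minimum \<open>0\<close> and greatest common divisor \<open>1\<close>, Kneser's theorem
  modulo the larger maximum \<open>l\<close> yields \<open>l \<le> |A| + |B| - 3\<close>. A lattice walk counting the elements of \<open>A\<close> and \<open>B\<close> then shows that all
  gaps of \<open>A + B\<close> below \<open>l\<close> precede, modulo \<open>l\<close>, those above \<open>l\<close>. Hence \<open>A + B\<close> contains an interval of length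
  \<open>|A| + |B| - 1\<close>, and the progression for \<open>C\<close> is the negated complement of its reduction modulo \<open>p\<close>.
\<close>

text \<open>The base 2 logarithm comes from the minors. The row of a relation
  \<open>a + b = c + d\<close> is a sum of two difference rows, matrices of difference rows are
  totally unimodular, and so by multilinearity each relation row costs at most a factor 2. Relation
  rows annihilate the constant vector, so a nonsingular matrix has at most \<open>n - 1\<close> of
  them, where \<open>n = |A \<union> B|\<close>; the ceiling gives \<open>2 ^ (n - 1) < p\<close>.

  The modulus \<open>l\<close> need not be prime, so residues may concentrate on cosets of a
  subgroup. The obstacle is to show that this makes the integer sumset too large although Kneser's
  bound alone is then weak.

  The unit \<delta> is spent when the two normalized integer sets coincide: only then do both the
  residue count and the gap count end one short of a contradiction.

  The bound for \<open>C\<close> matches the other two because an interval of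
  \<open>|A| + |B| - 1\<close> elements misses \<open>r + 1\<close> elements of
  \<open>A + B\<close>.\<close>

section \<open>Kneser's theorem\<close>

definition stabilizer :: "'a::ab_group_add set \<Rightarrow> 'a set" where
  "stabilizer C = {t. (+) t ` C = C}"

lemma stabilizer_iff: "t \<in> stabilizer C \<longleftrightarrow> (\<forall>x. t + x \<in> C \<longleftrightarrow> x \<in> C)"
proof
  assume t: "t \<in> stabilizer C"
  then have e: "(+) t ` C = C" by (simp add: stabilizer_def)
  show "\<forall>x. t + x \<in> C \<longleftrightarrow> x \<in> C"
  proof
    fix x
    have "t + x \<in> (+) t ` C \<longleftrightarrow> x \<in> C" by auto
    then show "t + x \<in> C \<longleftrightarrow> x \<in> C" using e by simp
  qed
next
  assume h: "\<forall>x. t + x \<in> C \<longleftrightarrow> x \<in> C"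
  have "y \<in> (+) t ` C" if "y \<in> C" for y
    using that h[rule_format, of "y - t"] by (intro image_eqI[of _ _ "y - t"]) auto
  then show "t \<in> stabilizer C" using h by (auto simp: stabilizer_def)
qed

lemma stabilizer_add_iff: "t \<in> stabilizer C \<Longrightarrow> t + x \<in> C \<longleftrightarrow> x \<in> C"
  by (simp add: stabilizer_iff)

lemma zero_in_stabilizer [simp]: "0 \<in> stabilizer C"
  by (simp add: stabilizer_iff)

lemma stabilizer_add: "s \<in> stabilizer C \<Longrightarrow> t \<in> stabilizer C \<Longrightarrow> s + t \<in> stabilizer C"
  by (simp add: stabilizer_iff add.assoc)

lemma stabilizer_uminus: "s \<in> stabilizer C \<Longrightarrow> - s \<in> stabilizer C"
  by (metis stabilizer_iff add_minus_cancel minus_add_cancel)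

lemma stabilizer_diff: "s \<in> stabilizer C \<Longrightarrow> t \<in> stabilizer C \<Longrightarrow> s - t \<in> stabilizer C"
  using stabilizer_add[of s C "- t"] stabilizer_uminus[of t C] by simp

lemma finite_stabilizer:
  assumes "finite C" "C \<noteq> {}"
  shows "finite (stabilizer C)"
proof -
  obtain c where "c \<in> C" using assms by auto
  then have "(\<lambda>t. t + c) ` stabilizer C \<subseteq> C" by (auto simp: stabilizer_iff)
  moreover have "inj_on (\<lambda>t. t + c) (stabilizer C)" by (auto simp: inj_on_def)
  ultimately show ?thesis using assms(1) finite_imageD finite_subset by blast
qed

lemma card_translate [simp]: "card ((+) z ` H) = card (H :: 'a::ab_group_add set)"
  by (rule card_image) auto

section \<open>Unions of sets with large stabilizers\<close>

context
  fixes C D :: "'a::ab_group_add set"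
  assumes fin: "finite C" "finite D" and ne: "C \<noteq> {}" "D \<noteq> {}"
begin

text \<open>The translate of \<open>stabilizer C\<close> through a point outside \<open>C\<close>
  avoids \<open>C\<close>, and that of \<open>stabilizer D\<close> through a point of
  \<open>D\<close> stays in \<open>D\<close>. Both pieces therefore lie in \<open>D - C\<close>, and
  they overlap in at most a translate of the common stabilizer.\<close>

lemma card_diff_ge_cross:
  assumes "z \<in> D - C"
  shows "card ((+) z ` stabilizer C \<inter> D) + card ((+) z ` stabilizer D - C)
    \<le> card (D - C) + card (stabilizer C \<inter> stabilizer D)"
proof -
  let ?X = "(+) z ` stabilizer C \<inter> D" and ?Y = "(+) z ` stabilizer D - C"
  have fX: "finite ?X" "finite ?Y" using fin ne by (auto intro: finite_stabilizer)
  have "z + t \<notin> C" if "t \<in> stabilizer C" for t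
    using stabilizer_add_iff[OF that, of z] assms by (simp add: add.commute)
  moreover have "z + t \<in> D" if "t \<in> stabilizer D" for t
    using stabilizer_add_iff[OF that, of z] assms by (simp add: add.commute)
  ultimately have "?X \<union> ?Y \<subseteq> D - C" by blast
  then have "card (?X \<union> ?Y) \<le> card (D - C)" using fin by (intro card_mono) auto
  moreover have "?X \<inter> ?Y \<subseteq> (+) z ` (stabilizer C \<inter> stabilizer D)" by auto
  then have "card (?X \<inter> ?Y) \<le> card ((+) z ` (stabilizer C \<inter> stabilizer D))"
    using finite_stabilizer[OF fin(1) ne(1)] by (intro card_mono finite_imageI finite_Int) auto
  then have "card (?X \<inter> ?Y) \<le> card (stabilizer C \<inter> stabilizer D)" by simp
  ultimately show ?thesis using card_Un_Int[OF fX] by linarith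
qed

text \<open>If \<open>z + stabilizer C\<close> leaves \<open>D\<close> at \<open>z + u\<close>, then
  all of \<open>z + u + stabilizer D\<close> is outside \<open>D\<close>, hence outside
  \<open>C\<close> by \<open>no\<close>; shifting back by \<open>u\<close> places
  \<open>z + stabilizer D\<close> inside \<open>D - C\<close>.\<close>

lemma card_diff_ge_stabilizer:
  assumes z: "z \<in> D - C"
    and no: "\<And>u v. u \<in> stabilizer C \<Longrightarrow> v \<in> stabilizer D \<Longrightarrow> z + u + v \<notin> C - D"
  shows "card (stabilizer C) \<le> card (D - C) \<or> card (stabilizer D) \<le> card (D - C)"
proof (cases "(+) z ` stabilizer C \<subseteq> D")
  case True
  have "(+) z ` stabilizer C \<inter> C = {}"
    using z by (auto simp: add.commute[of z] stabilizer_add_iff)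
  with True have "(+) z ` stabilizer C \<subseteq> D - C" by blast
  then have "card ((+) z ` stabilizer C) \<le> card (D - C)" using fin by (intro card_mono) auto
  then show ?thesis by simp
next
  case False
  then obtain u where u: "u \<in> stabilizer C" "z + u \<notin> D" by blast
  have "z + v \<notin> C" if v: "v \<in> stabilizer D" for v
  proof
    assume "z + v \<in> C"
    then have "z + u + v \<in> C" using stabilizer_add_iff[OF u(1), of "z + v"] by (simp add: ac_simps)
    then have "z + u + v \<in> D" using no[OF u(1) v] by blast
    then show False using u(2) stabilizer_add_iff[OF v, of "z + u"] by (simp add: ac_simps)
  qed
  moreover have "z + v \<in> D" if v: "v \<in> stabilizer D" for v
    using stabilizer_add_iff[OF v, of z] z by (simp add: ac_simps)
  ultimately have "(+) z ` stabilizer D \<subseteq> D - C" by blast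
  then have "card ((+) z ` stabilizer D) \<le> card (D - C)" using fin by (intro card_mono) auto
  then show ?thesis by simp
qed

end

text \<open>Adding \<open>u\<close> preserves \<open>H\<close> and adding \<open>v\<close> preserves
  \<open>D\<close>, so both translates of \<open>H\<close> meet \<open>D\<close> in equally many
  points.\<close>

lemma card_translate_Int:
  assumes fin: "finite H" and v: "v \<in> stabilizer D"
    and u: "\<And>h. u + h \<in> H \<longleftrightarrow> h \<in> H"
  shows "card ((+) z ` H \<inter> D) + card ((+) (z + u + v) ` H - D) = card (H :: 'a::ab_group_add set)"
proof -
  have "(+) u ` H = H"
    using u stabilizer_iff[of u H] by (simp add: stabilizer_def)
  moreover have "(+) (z + u + v) ` H = (+) (z + v) ` (+) u ` H"
    by (simp add: image_image ac_simps)
  ultimately have H: "(+) (z + u + v) ` H = (+) v ` (+) z ` H"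
    by (simp add: image_image ac_simps)
  have "(+) v ` D = D" using v by (simp add: stabilizer_def)
  then have "(+) (z + u + v) ` H \<inter> D = (+) v ` ((+) z ` H \<inter> D)"
    unfolding H by (metis image_Int inj_on_add)
  then have "card ((+) z ` H \<inter> D) = card ((+) (z + u + v) ` H \<inter> D)" by simp
  moreover have "card ((+) (z + u + v) ` H \<inter> D) + card ((+) (z + u + v) ` H - D)
      = card ((+) (z + u + v) ` H)"
    using fin by (intro card_Int_Diff[symmetric]) simp
  ultimately show ?thesis by simp
qed

text \<open>
  Let \<open>z \<in> D - C\<close> and \<open>z' \<in> C - D\<close>, with stabilizers \<open>H\<close> of \<open>C\<close> and \<open>I\<close> of \<open>D\<close>. If \<open>z\<close> and \<open>z'\<close> lie in
  the same coset of \<open>H + I\<close>, the bounds that \<open>card_diff_ge_cross\<close> gives at the two points add up to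
  \<open>|D - C| + |C - D| + 2 |H \<inter> I| \<ge> |H| + |I|\<close>, so one of the two sets loses no more from its
  stabilizer than the union gains in size.
\<close>

lemma card_Un_stabilizer_ge:
  fixes C D :: "'a::ab_group_add set"
  assumes fin: "finite C" "finite D" and ne: "C \<noteq> {}" "D \<noteq> {}"
    and n: "n \<le> card C + card (stabilizer C)" "n \<le> card D + card (stabilizer D)"
  shows "n \<le> card (C \<union> D) + card (stabilizer (C \<union> D))"
proof (cases "C \<subseteq> D \<or> D \<subseteq> C")
  case True
  then have "C \<union> D = C \<or> C \<union> D = D" by blast
  then show ?thesis using n by auto
next
  case False
  let ?H = "stabilizer C" and ?I = "stabilizer D"
  have "?H \<inter> ?I \<subseteq> stabilizer (C \<union> D)" by (auto simp: stabilizer_iff)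
  moreover have "finite (stabilizer (C \<union> D))" using fin ne by (intro finite_stabilizer) auto
  ultimately have k: "card (?H \<inter> ?I) \<le> card (stabilizer (C \<union> D))" by (rule card_mono[rotated])
  have "card ?H \<le> card (D - C) + card (?H \<inter> ?I) \<or> card ?I \<le> card (C - D) + card (?H \<inter> ?I)"
  proof (cases "\<exists>z u v. z \<in> D - C \<and> u \<in> ?H \<and> v \<in> ?I \<and> z + u + v \<in> C - D")
    case True
    then obtain z u v where z: "z \<in> D - C" and u: "u \<in> ?H" and v: "v \<in> ?I" and z': "z + u + v \<in> C - D"
      by blast
    have stab: "t + h \<in> stabilizer E \<longleftrightarrow> h \<in> stabilizer E" if "t \<in> stabilizer E" for t h and E :: "'a set"
      using stabilizer_add[OF that] stabilizer_diff[OF _ that, of "t + h"] by auto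
    have "card ((+) z ` ?H \<inter> D) + card ((+) (z + u + v) ` ?H - D) = card ?H"
      using fin ne u by (intro card_translate_Int v finite_stabilizer stab) auto
    moreover have "card ((+) (z + u + v) ` ?I \<inter> C) + card ((+) (z + u + v + (- v) + (- u)) ` ?I - C) = card ?I"
      using fin ne u v by (intro card_translate_Int finite_stabilizer stab stabilizer_uminus) auto
    moreover have "z + u + v + (- v) + (- u) = z" by simp
    moreover note card_diff_ge_cross[OF fin ne z] card_diff_ge_cross[OF fin(2,1) ne(2,1) z']
    moreover have "card (?I \<inter> ?H) = card (?H \<inter> ?I)" by (simp add: Int_commute)
    ultimately show ?thesis by (simp only:) linarith
  next
    case no: False
    obtain z z' where z: "z \<in> D - C" and z': "z' \<in> C - D" using False by blast
    have "card ?H \<le> card (D - C) \<or> card ?I \<le> card (D - C)"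
      using no z by (intro card_diff_ge_stabilizer fin ne) auto
    moreover have "z' + u + v \<notin> D - C" if u: "u \<in> ?I" and v: "v \<in> ?H" for u v
    proof
      assume "z' + u + v \<in> D - C"
      moreover have "z' + u + v + (- v) + (- u) = z'" by simp
      ultimately show False using no z' stabilizer_uminus[OF u] stabilizer_uminus[OF v] by metis
    qed
    then have "card ?I \<le> card (C - D) \<or> card ?H \<le> card (C - D)"
      using z' by (intro card_diff_ge_stabilizer fin ne) auto
    \<comment> \<open>In the crossed case \<open>|?I| \<le> |D - C|\<close> and
      \<open>|?H| \<le> |C - D|\<close>, comparing \<open>|?H|\<close> with \<open>|?I|\<close>
      turns one of the bounds into a wanted one.\<close>
    ultimately show ?thesis by linarith
  qed
  moreover have "card (C \<union> D) = card C + card (D - C)"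
    using fin card_Un_disjoint[of C "D - C"] by (simp add: Un_Diff_cancel)
  moreover have "card (C \<union> D) = card D + card (C - D)"
    using fin card_Un_disjoint[of D "C - D"] by (simp add: Un_Diff_cancel Un_commute)
  ultimately show ?thesis using n k by linarith
qed

text \<open>
  Dyson's transform: \<open>A\<close> absorbs \<open>e + B\<close> while \<open>B\<close> shrinks to \<open>B \<inter> (A - e)\<close>; this preserves
  \<open>|A| + |B|\<close>, and when no transform shrinks \<open>B\<close>, the set \<open>B\<close> lies in the stabilizer of \<open>A\<close>.
\<close>

lemma exists_subset_sumset_stabilizer:
  fixes A B :: "'a::ab_group_add set"
  assumes "finite A" "finite B" "a \<in> A" "b \<in> B"
  shows "\<exists>C \<subseteq> A + B. a + b \<in> C \<and> card A + card B \<le> card C + card (stabilizer C)"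
  using assms
proof (induction "card B" arbitrary: A B a b rule: less_induct)
  case less
  \<comment> \<open>With \<open>0\<close> in the second set, \<open>A \<subseteq> A + B0\<close>,
    and the transform keeps both \<open>0\<close> and the marked element \<open>a\<close>.\<close>
  define B0 where "B0 = (+) (- b) ` B"
  have cB0: "card B0 = card B" unfolding B0_def by (rule card_translate)
  have fB0: "finite B0" "0 \<in> B0" using less.prems by (auto simp: B0_def image_iff)
  have AB0: "A + B = (+) b ` (A + B0)"
  proof (intro equalityI subsetI)
    fix s assume "s \<in> A + B"
    then obtain x y where xy: "x \<in> A" "y \<in> B" "s = x + y" by (rule set_plus_elim)
    then have "x + (- b + y) \<in> A + B0" unfolding B0_def by (intro set_plus_intro imageI)
    moreover have "s = b + (x + (- b + y))" using xy by simp
    ultimately show "s \<in> (+) b ` (A + B0)" by (rule rev_image_eqI)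
  next
    fix s assume "s \<in> (+) b ` (A + B0)"
    then obtain x y where "x \<in> A" "y \<in> B" "s = b + (x + (- b + y))"
      unfolding B0_def by (blast elim: set_plus_elim)
    then show "s \<in> A + B" by (simp add: set_plus_intro)
  qed
  have "\<exists>C \<subseteq> A + B0. a \<in> C \<and> card A + card B \<le> card C + card (stabilizer C)"
  proof (cases "\<forall>e\<in>A. \<forall>x\<in>B0. e + x \<in> A")
    case True
    have "B0 \<subseteq> stabilizer A"
    proof
      fix x assume x: "x \<in> B0"
      have "(+) x ` A = A"
      proof (rule card_subset_eq)
        show "(+) x ` A \<subseteq> A" using True x by (auto simp: add.commute)
      qed (use less.prems in auto)
      then show "x \<in> stabilizer A" by (simp add: stabilizer_def)
    qed
    then have "card B \<le> card (stabilizer A)"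
        unfolding cB0[symmetric] using less.prems by (intro card_mono finite_stabilizer) auto
    moreover have "A \<subseteq> A + B0" using set_zero_plus2[OF fB0(2), of A] by (simp add: add.commute)
    ultimately show ?thesis using less.prems(3) by (intro exI[of _ A] conjI) simp_all
  next
    case False
    then obtain e x where e: "e \<in> A" and x: "x \<in> B0" "e + x \<notin> A" by blast
    define A1 where "A1 = A \<union> (+) e ` B0"
    define B1 where "B1 = {y \<in> B0. e + y \<in> A}"
    have fin: "finite A1" "finite B1" using less.prems fB0 by (auto simp: A1_def B1_def)
    have "B1 \<subset> B0" using x by (auto simp: B1_def)
    then have "card B1 < card B" using psubset_card_mono[OF fB0(1)] cB0 by simp
    moreover have "a \<in> A1" using less.prems by (simp add: A1_def)
    moreover have "0 \<in> B1" using e fB0 by (simp add: B1_def)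
    ultimately obtain C where C: "C \<subseteq> A1 + B1" "a + 0 \<in> C"
      "card A1 + card B1 \<le> card C + card (stabilizer C)"
      using less.hyps[of B1 A1 a 0] fin by blast
    have "A1 + B1 \<subseteq> A + B0"
    proof
      fix s assume "s \<in> A1 + B1"
      then obtain c y where cy: "c \<in> A1" "y \<in> B1" "s = c + y" by (rule set_plus_elim)
      show "s \<in> A + B0"
      proof (cases "c \<in> A")
        case True
        then show ?thesis using cy by (auto simp: B1_def)
      next
        case False
        then obtain w where w: "w \<in> B0" "c = e + w" using cy by (auto simp: A1_def)
        then have "s = (e + y) + w" using cy by (simp add: ac_simps)
        moreover have "e + y \<in> A" using cy by (simp add: B1_def)
        ultimately show ?thesis using w by (simp add: set_plus_intro)
      qed
    qed
    moreover have "card A1 + card B1 = card A + card B"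
    proof -
      have "A \<inter> (+) e ` B0 = (+) e ` B1" by (auto simp: B1_def)
      then show ?thesis
        using card_Un_Int[of A "(+) e ` B0"] less.prems fB0 cB0 by (simp add: A1_def)
    qed
    ultimately show ?thesis using C by (intro exI[of _ C]) auto
  qed
  then obtain C where C: "C \<subseteq> A + B0" "a \<in> C" "card A + card B \<le> card C + card (stabilizer C)"
    by blast
  have "stabilizer ((+) b ` C) = stabilizer C"
  proof (intro Set.set_eqI)
    fix t
    have "(+) t ` (+) b ` C = (+) b ` (+) t ` C" by (simp add: image_image ac_simps)
    then show "t \<in> stabilizer ((+) b ` C) \<longleftrightarrow> t \<in> stabilizer C"
      by (auto simp: stabilizer_def inj_image_eq_iff)
  qed
  then have "card A + card B \<le> card ((+) b ` C) + card (stabilizer ((+) b ` C))" using C by simp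
  moreover have "(+) b ` C \<subseteq> A + B" using C AB0 by auto
  moreover have "a + b \<in> (+) b ` C" using C(2) by (simp add: add.commute)
  ultimately show ?case by blast
qed

text \<open>Each single sum lies in a subset of \<open>A + B\<close> that satisfies the bound, and
  the bound survives unions; finitely many unions exhaust \<open>A + B\<close>.\<close>

theorem Kneser_weak:
  fixes A B :: "'a::ab_group_add set"
  assumes fin: "finite A" "finite B" and ne: "A \<noteq> {}" "B \<noteq> {}"
  shows "card A + card B \<le> card (A + B) + card (stabilizer (A + B))"
proof -
  have fS: "finite (A + B)" using fin by (rule finite_set_plus)
  have ex: "\<exists>C. F \<subseteq> C \<and> C \<subseteq> A + B \<and> card A + card B \<le> card C + card (stabilizer C)"
    if "finite F" "F \<noteq> {}" "F \<subseteq> A + B" for F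
    using that
  proof (induction F rule: finite_ne_induct)
    case (singleton x)
    then obtain a b where "a \<in> A" "b \<in> B" "x = a + b" by (auto elim: set_plus_elim)
    then show ?case using exists_subset_sumset_stabilizer[OF fin] by blast
  next
    case (insert x F)
    then obtain C where C: "F \<subseteq> C" "C \<subseteq> A + B" "card A + card B \<le> card C + card (stabilizer C)"
      by auto
    obtain a b where "a \<in> A" "b \<in> B" "x = a + b" using insert.prems by (auto elim: set_plus_elim)
    then obtain D where D: "D \<subseteq> A + B" "x \<in> D" "card A + card B \<le> card D + card (stabilizer D)"
      using exists_subset_sumset_stabilizer[OF fin] by blast
    have "card A + card B \<le> card (C \<union> D) + card (stabilizer (C \<union> D))"
      using C D insert.hyps fS by (intro card_Un_stabilizer_ge) (auto intro: finite_subset)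
    then show ?case using C D by (intro exI[of _ "C \<union> D"]) auto
  qed
  have "A + B \<noteq> {}" using ne by (auto simp: set_plus_def)
  then obtain C where "A + B \<subseteq> C" "C \<subseteq> A + B" "card A + card B \<le> card C + card (stabilizer C)"
    using ex[OF fS _ subset_refl] by blast
  moreover from this have "C = A + B" by blast
  ultimately show ?thesis by simp
qed

text \<open>The weak form is applied to \<open>A + K\<close> and \<open>B + K\<close>, whose sumset
  is still \<open>A + B\<close>.\<close>

theorem Kneser:
  fixes A B :: "'a::ab_group_add set"
  assumes fin: "finite A" "finite B" and ne: "A \<noteq> {}" "B \<noteq> {}"
  defines "K \<equiv> stabilizer (A + B)"
  shows "card (A + K) + card (B + K) \<le> card (A + B) + card K"
proof -
  have fK: "finite K" unfolding K_def using fin ne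
    by (intro finite_stabilizer finite_set_plus) (auto simp: set_plus_def)
  have K0: "0 \<in> K" by (simp add: K_def)
  have "(A + K) + (B + K) = A + B"
  proof (intro equalityI subsetI)
    fix s assume "s \<in> (A + K) + (B + K)"
    then obtain x y where xy: "x \<in> A + K" "y \<in> B + K" "s = x + y" by (rule set_plus_elim)
    obtain a k where a: "a \<in> A" "k \<in> K" "x = a + k" using xy(1) by (rule set_plus_elim)
    obtain b l where b: "b \<in> B" "l \<in> K" "y = b + l" using xy(2) by (rule set_plus_elim)
    have "k + l \<in> K" using a b by (simp add: K_def stabilizer_add)
    moreover have "s = (k + l) + (a + b)" using xy a b by (simp add: ac_simps)
    moreover have "a + b \<in> A + B" using a b by (simp add: set_plus_intro)
    ultimately show "s \<in> A + B" unfolding K_def by (simp add: stabilizer_add_iff)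
  next
    fix s assume "s \<in> A + B"
    then obtain a b where ab: "a \<in> A" "b \<in> B" "s = a + b" by (rule set_plus_elim)
    then have "(a + 0) + (b + 0) \<in> (A + K) + (B + K)" using K0 by (intro set_plus_intro)
    then show "s \<in> (A + K) + (B + K)" using ab by simp
  qed
  moreover have "A + K \<noteq> {}" "B + K \<noteq> {}" using ne K0 by (auto simp: set_plus_def)
  moreover have "finite (A + K)" "finite (B + K)" using fin fK by (simp_all add: finite_set_plus)
  ultimately show ?thesis
    using Kneser_weak[of "A + K" "B + K"] by (simp add: K_def)
qed

section \<open>Sumsets of integers and their residues\<close>

text \<open>
  The residues modulo a variable \<open>l\<close> do not form a type, but they embed into the circle group, which
  makes the type-class version of Kneser's theorem available for all moduli at once.
\<close>

quotient_type circle = real / "\<lambda>x y. x - y \<in> \<int>"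
proof (rule equivpI)
  show "symp (\<lambda>x y :: real. x - y \<in> \<int>)"
    by (rule sympI) (metis Ints_minus minus_diff_eq)
  show "transp (\<lambda>x y :: real. x - y \<in> \<int>)"
    by (rule transpI) (metis Ints_add diff_add_cancel add_diff_eq)
qed (simp add: reflp_def)

instantiation circle :: ab_group_add
begin

lift_definition zero_circle :: circle is "0::real" .

lift_definition plus_circle :: "circle \<Rightarrow> circle \<Rightarrow> circle" is "(+)"
  by (metis Ints_add add_diff_add)

lift_definition uminus_circle :: "circle \<Rightarrow> circle" is uminus
  by (metis Ints_minus minus_diff_minus)

lift_definition minus_circle :: "circle \<Rightarrow> circle \<Rightarrow> circle" is "(-)"
  by (metis (no_types, opaque_lifting) Ints_diff diff_diff_eq diff_diff_eq2 diff_add_eq add.commute)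

instance
  by standard (transfer; simp add: algebra_simps)+

end

text \<open>Division by \<open>l\<close> identifies the residues with the fractions of denominator
  \<open>l\<close> on the circle.\<close>

lemma exists_hom_kernel_multiples:
  assumes "l > 0"
  shows "\<exists>\<phi> :: int \<Rightarrow> circle. (\<forall>x y. \<phi> (x + y) = \<phi> x + \<phi> y) \<and> (\<forall>x y. \<phi> x = \<phi> y \<longleftrightarrow> l dvd x - y)"
proof (intro exI conjI allI)
  fix x y :: int
  let ?\<phi> = "\<lambda>x :: int. abs_circle (real_of_int x / real_of_int l)"
  show "?\<phi> (x + y) = ?\<phi> x + ?\<phi> y"
    by (simp add: plus_circle.abs_eq add_divide_distrib)
  have "real_of_int x / real_of_int l - real_of_int y / real_of_int l = real_of_int (x - y) / real_of_int l"
    by (simp add: diff_divide_distrib)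
  moreover have "real_of_int z / real_of_int l \<in> \<int> \<longleftrightarrow> l dvd z" for z
  proof
    assume "real_of_int z / real_of_int l \<in> \<int>"
    then obtain k where "real_of_int z / real_of_int l = real_of_int k" by (rule Ints_cases)
    then have "real_of_int z = real_of_int (l * k)" using assms by (simp add: field_simps)
    then show "l dvd z" by (metis dvd_triv_left of_int_eq_iff)
  next
    assume "l dvd z"
    then show "real_of_int z / real_of_int l \<in> \<int>" using assms by (auto elim!: dvdE)
  qed
  ultimately show "?\<phi> x = ?\<phi> y \<longleftrightarrow> l dvd x - y"
    unfolding circle.abs_eq_iff by (simp only:)
qed

text \<open>The translates \<open>A + Min B\<close> and \<open>Max A + B\<close> share only
  \<open>Max A + Min B\<close>.\<close>

lemma card_sumset_ge:
  fixes A B :: "int set"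
  assumes fin: "finite A" "finite B" and ne: "A \<noteq> {}" "B \<noteq> {}"
  shows "card A + card B \<le> card (A + B) + 1"
proof -
  let ?X = "(\<lambda>a. a + Min B) ` A" and ?Y = "(+) (Max A) ` B"
  have "Min B \<in> B" "Max A \<in> A" using fin ne by auto
  then have "?X \<union> ?Y \<subseteq> A + B" by (auto intro!: set_plus_intro)
  then have "card (?X \<union> ?Y) \<le> card (A + B)" using fin by (intro card_mono finite_set_plus)
  moreover have "?X \<inter> ?Y \<subseteq> {Max A + Min B}"
  proof
    fix y assume "y \<in> ?X \<inter> ?Y"
    then obtain a b where "a \<in> A" "b \<in> B" "y = a + Min B" "y = Max A + b" by auto
    moreover from this have "a \<le> Max A" "Min B \<le> b" using fin by auto
    ultimately show "y \<in> {Max A + Min B}" by auto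
  qed
  then have "card (?X \<inter> ?Y) \<le> 1" using card_mono[of "{Max A + Min B}"] by simp
  moreover have "card ?X = card A" by (rule card_image) (auto simp: inj_on_def)
  ultimately show ?thesis using card_Un_Int[of ?X ?Y] fin by simp
qed

section \<open>Reduction modulo \<open>l\<close> as a homomorphism\<close>

locale mod_hom =
  fixes \<phi> :: "int \<Rightarrow> 'a::ab_group_add" and l :: int
  assumes add: "\<phi> (x + y) = \<phi> x + \<phi> y"
    and eq_iff: "\<phi> x = \<phi> y \<longleftrightarrow> l dvd x - y"
    and l_pos: "l > 0"
begin

lemma zero [simp]: "\<phi> 0 = 0"
  using add[of 0 0] by simp

lemma period [simp]: "\<phi> l = 0"
  using eq_iff[of l 0] by simp

lemma uminus: "\<phi> (- x) = - \<phi> x"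
  using add[of x "- x"] by (simp add: eq_neg_iff_add_eq_0 add.commute)

lemma diff: "\<phi> (x - y) = \<phi> x - \<phi> y"
  using add[of x "- y"] uminus by simp

lemma image_sumset: "\<phi> ` (A + B) = \<phi> ` A + \<phi> ` B"
  by (force simp: set_plus_def add)

lemma range_eq: "range \<phi> = \<phi> ` {0..<l}"
proof -
  have "\<phi> x \<in> \<phi> ` {0..<l}" for x
  proof -
    have "\<phi> x = \<phi> (x mod l)" by (simp add: eq_iff)
    then show ?thesis using l_pos by (intro image_eqI[of _ _ "x mod l"]) auto
  qed
  then show ?thesis by auto
qed

lemma inj_on_residues: "inj_on \<phi> {0..<l}"
  by (auto simp: inj_on_def eq_iff) (metis mod_eq_dvd_iff mod_pos_pos_trivial)

lemma card_range: "card (range \<phi>) = nat l"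
  unfolding range_eq by (simp add: card_image inj_on_residues)

text \<open>Within \<open>{0..l}\<close> only \<open>0\<close> and \<open>l\<close> share a
  residue.\<close>

lemma card_image_ge:
  assumes "A \<subseteq> {0..l}"
  shows "card A \<le> card (\<phi> ` A) + 1" "l \<notin> A \<Longrightarrow> card (\<phi> ` A) = card A"
proof -
  have fin: "finite A" using assms finite_subset by blast
  have inj: "inj_on \<phi> (A - {l})"
    by (rule inj_on_subset[OF inj_on_residues]) (use assms in force)
  have "card (A - {l}) = card (\<phi> ` (A - {l}))" using inj by (simp add: card_image)
  also have "\<dots> \<le> card (\<phi> ` A)" using fin by (intro card_mono) auto
  finally show "card A \<le> card (\<phi> ` A) + 1"
    using fin by (simp add: card_Diff_singleton_if split: if_splits)
  show "card (\<phi> ` A) = card A" if "l \<notin> A" using inj that by (simp add: card_image)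
qed

text \<open>The least positive \<open>d\<close> with residue in \<open>K\<close> generates the
  preimage of \<open>K\<close>, so it divides every element of \<open>A\<close> and equals
  \<open>1\<close>.\<close>

lemma residues_in_subgroup:
  assumes K: "0 \<in> K" "\<And>x y. x \<in> K \<Longrightarrow> y \<in> K \<Longrightarrow> x + y \<in> K" "\<And>x. x \<in> K \<Longrightarrow> - x \<in> K"
    and A: "\<And>x. x \<in> A \<Longrightarrow> \<phi> x \<in> K"
    and gcd: "\<And>d. (\<And>x. x \<in> A \<Longrightarrow> d dvd x) \<Longrightarrow> d dvd 1"
  shows "range \<phi> \<subseteq> K"
proof -
  define P where "P = (\<lambda>n::nat. n > 0 \<and> \<phi> (int n) \<in> K)"
  have "P (nat l)" using l_pos K by (simp add: P_def)
  then have Pd: "P (LEAST n. P n)" by (rule LeastI)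
  define d where "d = int (LEAST n. P n)"
  have d: "d > 0" "\<phi> d \<in> K" using Pd by (auto simp: d_def P_def)
  have nat_mult: "\<phi> (int n * d) \<in> K" for n
    by (induction n) (use K d add in \<open>auto simp: algebra_simps\<close>)
  have mult: "\<phi> (k * d) \<in> K" for k
  proof (cases k rule: int_cases2)
    case (nonneg n)
    then show ?thesis using nat_mult by simp
  next
    case (nonpos n)
    then show ?thesis using nat_mult[of n] K(3) by (simp add: uminus)
  qed
  have "d dvd x" if x: "\<phi> x \<in> K" for x
  proof (rule ccontr)
    assume nd: "\<not> d dvd x"
    have "\<phi> (x mod d) = \<phi> x + - \<phi> (x div d * d)" by (simp add: minus_div_mult_eq_mod[symmetric] diff)
    then have "\<phi> (x mod d) \<in> K" using x mult K by metis
    moreover have "0 < x mod d" using pos_mod_sign[OF d(1), of x] nd by (auto simp: dvd_eq_mod_eq_0 order_le_less)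
    ultimately have "P (nat (x mod d))" by (simp add: P_def)
    then have "(LEAST n. P n) \<le> nat (x mod d)" by (rule Least_le)
    then have "d \<le> x mod d" using \<open>0 < x mod d\<close> by (simp add: d_def)
    then show False using d pos_mod_bound[of d x] by linarith
  qed
  then have "d dvd 1" using gcd A by blast
  then have "d = 1" using d by auto
  then show ?thesis using mult by auto
qed

text \<open>\<open>W\<close> consists of spare elements: without them every residue outside
  \<open>E\<close> is still hit. The three terms count disjoint parts of \<open>S\<close>, the
  fibres over \<open>E\<close> with full multiplicity.\<close>

lemma card_fibre:
  assumes fin: "finite S" and W: "W \<subseteq> S" "\<phi> ` W \<inter> E = {}"
    and rep: "\<And>s. s \<in> W \<Longrightarrow> \<exists>t \<in> S - W. \<phi> t = \<phi> s"
  shows "card W + card (\<phi> ` S - E) + card {s \<in> S. \<phi> s \<in> E} \<le> card S"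
proof -
  define T where "T = {s \<in> S - W. \<phi> s \<notin> E}"
  have "\<phi> ` S - E \<subseteq> \<phi> ` T"
  proof
    fix z assume "z \<in> \<phi> ` S - E"
    then obtain s where s: "s \<in> S" "z = \<phi> s" "z \<notin> E" by auto
    then obtain t where "t \<in> S - W" "\<phi> t = \<phi> s" using rep by (cases "s \<in> W") auto
    then show "z \<in> \<phi> ` T" using s by (auto simp: T_def image_iff)
  qed
  then have "card (\<phi> ` S - E) \<le> card (\<phi> ` T)" using fin by (intro card_mono) (auto simp: T_def)
  also have "\<dots> \<le> card T" using fin by (intro card_image_le) (auto simp: T_def)
  finally have "card (\<phi> ` S - E) \<le> card T" .
  moreover have "card (W \<union> T \<union> {s \<in> S. \<phi> s \<in> E}) = card W + card T + card {s \<in> S. \<phi> s \<in> E}"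
    using fin W by (subst card_Un_disjoint card_Un_disjoint; (auto simp: T_def intro: finite_subset)?)+
  moreover have "card (W \<union> T \<union> {s \<in> S. \<phi> s \<in> E}) \<le> card S"
    using fin W by (intro card_mono) (auto simp: T_def)
  ultimately show ?thesis by linarith
qed

text \<open>Over the coset of \<open>K\<close> through \<open>\<phi> (a + b)\<close> lies the sumset
  of the fibres through \<open>a\<close> and \<open>b\<close>, which \<open>card_sumset_ge\<close>
  bounds below. The remaining residues count once, and the elements of \<open>W\<close> come on
  top.\<close>

lemma card_sumset_ge_fibre:
  assumes fin: "finite A" "finite B" and W: "W \<subseteq> A + B"
    and rep: "\<And>s. s \<in> W \<Longrightarrow> \<exists>t \<in> A + B - W. \<phi> t = \<phi> s"
    and ab: "a \<in> A" "b \<in> B"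
  defines "K \<equiv> stabilizer (\<phi> ` (A + B))"
  assumes disj: "\<And>s. s \<in> W \<Longrightarrow> \<phi> s - \<phi> (a + b) \<notin> K"
  shows "card W + card (\<phi> ` (A + B)) + card {x \<in> A. \<phi> x - \<phi> a \<in> K} + card {x \<in> B. \<phi> x - \<phi> b \<in> K}
    \<le> card (A + B) + card K + 1"
proof -
  let ?S = "A + B"
  define E where "E = (+) (\<phi> (a + b)) ` K"
  have E: "z \<in> E \<longleftrightarrow> z - \<phi> (a + b) \<in> K" for z
    by (auto simp: E_def image_iff intro: bexI[of _ "z - \<phi> (a + b)"])
  have fS: "finite ?S" using fin by (rule finite_set_plus)
  have ab': "a + b \<in> ?S" using ab by (rule set_plus_intro)
  have fK: "finite K" unfolding K_def using fS ab' by (intro finite_stabilizer) auto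
  have "E \<subseteq> \<phi> ` ?S"
  proof
    fix z assume "z \<in> E"
    then have "z - \<phi> (a + b) \<in> K" by (simp add: E)
    then have "(z - \<phi> (a + b)) + \<phi> (a + b) \<in> \<phi> ` ?S"
      unfolding K_def using ab' by (subst stabilizer_add_iff) auto
    then show "z \<in> \<phi> ` ?S" by simp
  qed
  then have "card (\<phi> ` ?S - E) = card (\<phi> ` ?S) - card E"
    using fS by (intro card_Diff_subset) (auto intro: finite_subset)
  moreover have "card E = card K" unfolding E_def by (rule card_translate)
  moreover have "card W + card (\<phi> ` ?S - E) + card {s \<in> ?S. \<phi> s \<in> E} \<le> card ?S"
    using disj by (intro card_fibre fS W rep) (auto simp: E)
  moreover have "card {x \<in> A. \<phi> x - \<phi> a \<in> K} + card {x \<in> B. \<phi> x - \<phi> b \<in> K}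
      \<le> card {s \<in> ?S. \<phi> s \<in> E} + 1"
  proof -
    let ?A = "{x \<in> A. \<phi> x - \<phi> a \<in> K}" and ?B = "{x \<in> B. \<phi> x - \<phi> b \<in> K}"
    have "a \<in> ?A" "b \<in> ?B" using ab by (auto simp: K_def)
    then have "card ?A + card ?B \<le> card (?A + ?B) + 1"
      using fin by (intro card_sumset_ge) auto
    also have "?A + ?B \<subseteq> {s \<in> ?S. \<phi> s \<in> E}"
    proof
      fix s assume "s \<in> ?A + ?B"
      then obtain x y where xy: "x \<in> ?A" "y \<in> ?B" "s = x + y" by (rule set_plus_elim)
      have "\<phi> s - \<phi> (a + b) = (\<phi> x - \<phi> a) + (\<phi> y - \<phi> b)" using xy by (simp add: add)
      then show "s \<in> {s \<in> ?S. \<phi> s \<in> E}"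
        using xy by (auto simp: E K_def stabilizer_add intro: set_plus_intro)
    qed
    then have "card (?A + ?B) \<le> card {s \<in> ?S. \<phi> s \<in> E}" using fS by (intro card_mono) auto
    finally show ?thesis by simp
  qed
  ultimately show ?thesis by linarith
qed

text \<open>The sum \<open>b + l\<close> repeats the residue of \<open>0 + b\<close>; for
  \<open>b = l\<close>, where this is not below \<open>l\<close>, the representative
  \<open>0\<close> takes over.\<close>

lemma sumset_reps:
  assumes B: "B \<subseteq> {0..l}" and 0: "0 \<in> A" "l \<in> A" "0 \<in> B"
  shows "(\<lambda>b. b + l) ` B \<subseteq> A + B"
    and "s \<in> (\<lambda>b. b + l) ` B \<Longrightarrow> \<exists>t \<in> A + B. t < l \<and> \<phi> t = \<phi> s"
proof -
  have "l + b \<in> A + B" if "b \<in> B" for b using 0(2) that by (rule set_plus_intro)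
  then show "(\<lambda>b. b + l) ` B \<subseteq> A + B" by (auto simp: add.commute)
  assume "s \<in> (\<lambda>b. b + l) ` B"
  then obtain b where b: "b \<in> B" "s = b + l" by auto
  show "\<exists>t \<in> A + B. t < l \<and> \<phi> t = \<phi> s"
  proof (cases "b = l")
    case True
    have "0 + 0 \<in> A + B" using 0 by (intro set_plus_intro)
    moreover have "\<phi> s = 0" using True b add[of l l] by simp
    ultimately show ?thesis using l_pos by (intro bexI[of _ 0]) auto
  next
    case False
    have "0 + b \<in> A + B" using 0 b by (intro set_plus_intro)
    then show ?thesis using False b B by (intro bexI[of _ b]) (auto simp: add)
  qed
qed

lemma card_sumset_ge_residues:
  assumes A: "finite A" and B: "B \<subseteq> {0..l}" and 0: "0 \<in> A" "l \<in> A" "0 \<in> B"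
  shows "card B + card (\<phi> ` (A + B)) \<le> card (A + B)"
proof -
  have "finite B" using B finite_subset by blast
  then have "finite (A + B)" using A by (intro finite_set_plus)
  moreover have "\<exists>t \<in> A + B - (\<lambda>b. b + l) ` B. \<phi> t = \<phi> s" if "s \<in> (\<lambda>b. b + l) ` B" for s
    using sumset_reps(2)[OF B 0 that] B by force
  moreover have "card ((\<lambda>b. b + l) ` B) = card B" by (rule card_image) (auto simp: inj_on_def)
  ultimately show ?thesis
    using card_fibre[of "A + B" "(\<lambda>b. b + l) ` B" "{}"] sumset_reps(1)[OF B 0] by simp
qed

text \<open>
  Write \<open>X\<close>, \<open>Y\<close> for the residues of \<open>A\<close>, \<open>B\<close> modulo \<open>l\<close>, and \<open>K\<close> for the stabilizer of \<open>X + Y\<close>. Since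
  \<open>0\<close> and \<open>l\<close> are both in \<open>A\<close>, every residue in \<open>Y\<close> is hit twice by \<open>A + B\<close>; and one coset of \<open>K\<close> outside
  \<open>Y + K\<close> carries many integers because it contains a sum of two nearly full fibres.
\<close>

lemma card_sumset_ge_not_covering:
  assumes A: "A \<subseteq> {0..l}" and B: "B \<subseteq> {0..l}" and 0: "0 \<in> A" "l \<in> A" "0 \<in> B"
    and gcd: "\<And>d. (\<And>x. x \<in> A \<union> B \<Longrightarrow> d dvd x) \<Longrightarrow> d dvd 1"
    and nc: "\<phi> ` (A + B) \<noteq> range \<phi>"
  shows "2 * card A + card B \<le> card (A + B) + 2 \<or>
    card A + 2 * card B \<le> card (A + B) + (if l \<in> B \<and> A \<subseteq> B then 3 else 2)"
proof -
  let ?S = "A + B" and ?X = "\<phi> ` A" and ?Y = "\<phi> ` B"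
  define K where "K = stabilizer (\<phi> ` ?S)"
  let ?k = "card K"
  have fin: "finite A" "finite B" using A B finite_subset by blast+
  then have fS: "finite ?S" by (rule finite_set_plus)
  have ne: "A \<noteq> {}" "B \<noteq> {}" using 0 by auto
  have "0 + 0 \<in> ?S" using 0 by (intro set_plus_intro)
  then have S0: "0 \<in> ?S" by simp
  have fK: "finite K" unfolding K_def using fS S0 by (intro finite_stabilizer) auto
  have K: "0 \<in> K" "\<And>x y. x \<in> K \<Longrightarrow> y \<in> K \<Longrightarrow> x + y \<in> K" "\<And>x. x \<in> K \<Longrightarrow> - x \<in> K"
    by (auto simp: K_def stabilizer_add stabilizer_uminus)
  have Kd: "x - y \<in> K" if "x \<in> K" "y \<in> K" for x y using that by (simp add: K_def stabilizer_diff)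
  have kn: "card (?X + K) + card (?Y + K) \<le> card (\<phi> ` ?S) + ?k"
    unfolding K_def image_sumset using fin ne by (intro Kneser) auto
  have X0: "0 \<in> ?X" and Y0: "0 \<in> ?Y" using 0 by (auto simp: image_iff intro: bexI[of _ 0])
  have fXK: "finite (?X + K)" "finite (?Y + K)" using fin fK by (auto intro: finite_set_plus)
  have subK: "M \<subseteq> M + K" for M using set_zero_plus2[OF K(1), of M] by (simp add: add.commute)
  have in_plusK: "z \<in> M + K \<longleftrightarrow> (\<exists>m\<in>M. z - m \<in> K)" for z M
  proof
    assume "z \<in> M + K"
    then obtain m k where "m \<in> M" "k \<in> K" "z = m + k" by (rule set_plus_elim)
    then show "\<exists>m\<in>M. z - m \<in> K" by (intro bexI[of _ m]) auto
  next
    assume "\<exists>m\<in>M. z - m \<in> K"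
    then obtain m where "m \<in> M" "z - m \<in> K" by auto
    then have "m + (z - m) \<in> M + K" by (rule set_plus_intro)
    then show "z \<in> M + K" by simp
  qed
  have closed: "x + k \<in> M + K \<longleftrightarrow> x \<in> M + K" if "k \<in> K" for x k M
    unfolding in_plusK using that K Kd by (metis add_diff_cancel_right' diff_add_eq add_diff_eq)
  \<comment> \<open>As \<open>C\<close> lies in \<open>M + K\<close>, it has at most as many points
    outside \<open>M\<close> as \<open>M + K\<close> has.\<close>
  have part: "card M + card C \<le> card (M \<inter> C) + card (M + K)" if "C \<subseteq> M + K" "finite M" for M C
  proof -
    have fMK: "finite (M + K)" using that fK by (intro finite_set_plus)
    have "card M = card (M \<inter> C) + card (M - C)" using that(2) by (rule card_Int_Diff)
    moreover have "card (M - C) \<le> card (M + K - C)"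
      using fMK subK[of M] by (intro card_mono) auto
    moreover have "card (M + K - C) + card C = card (M + K)"
      using that(1) fMK by (metis card_Diff_subset card_mono finite_subset le_add_diff_inverse2)
    ultimately show ?thesis by linarith
  qed
  have coset: "(+) (\<phi> a) ` K \<subseteq> \<phi> ` M + K" if "a \<in> M" for a M
    using that by (auto simp: in_plusK)
  have fibre: "card (\<phi> ` M \<inter> (+) (\<phi> a) ` K) \<le> card {x \<in> M. \<phi> x - \<phi> a \<in> K}" if "finite M" for a M
  proof -
    have "\<phi> ` M \<inter> (+) (\<phi> a) ` K \<subseteq> \<phi> ` {x \<in> M. \<phi> x - \<phi> a \<in> K}" by auto
    then have "card (\<phi> ` M \<inter> (+) (\<phi> a) ` K) \<le> card (\<phi> ` {x \<in> M. \<phi> x - \<phi> a \<in> K})"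
      using that by (intro card_mono) auto
    also have "\<dots> \<le> card {x \<in> M. \<phi> x - \<phi> a \<in> K}" using that by (intro card_image_le) auto
    finally show ?thesis .
  qed
  have hole: "card (\<phi> ` M) + ?k \<le> card {x \<in> M. \<phi> x - \<phi> a \<in> K} + card (\<phi> ` M + K)"
    if "a \<in> M" "finite M" for a M
  proof -
    have "card (\<phi> ` M) + card ((+) (\<phi> a) ` K)
        \<le> card (\<phi> ` M \<inter> (+) (\<phi> a) ` K) + card (\<phi> ` M + K)"
      using that by (intro part coset) auto
    also have "card ((+) (\<phi> a) ` K) = ?k" by (rule card_translate)
    finally show ?thesis using fibre[OF that(2), of a] by linarith
  qed
  have cX: "card A \<le> card ?X + 1" using card_image_ge(1)[OF A] .
  have cY: "card B \<le> card ?Y + 1" "l \<notin> B \<Longrightarrow> card ?Y = card B" using card_image_ge[OF B] .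
  define W where "W = (\<lambda>b. b + l) ` B"
  have cW: "card W = card B" unfolding W_def by (rule card_image) (auto simp: inj_on_def)
  have Wge: "s \<ge> l" if "s \<in> W" for s using that B by (auto simp: W_def)
  have WS: "W \<subseteq> ?S" unfolding W_def by (rule sumset_reps(1)[OF B 0])
  have Wrep: "\<exists>t \<in> ?S. t < l \<and> \<phi> t = \<phi> s" if "s \<in> W" for s
    using sumset_reps(2)[OF B 0] that unfolding W_def by blast
  have WY: "\<phi> s \<in> ?Y + K" if "s \<in> W" for s
    using that subK[of ?Y] by (auto simp: W_def add)
  have bound: "card V + card (\<phi> ` ?S) + card {x \<in> A. \<phi> x - \<phi> a \<in> K} + card {x \<in> B. \<phi> x - \<phi> b \<in> K}
      \<le> card ?S + ?k + 1"
    if V: "V \<subseteq> ?S" "\<And>s. s \<in> V \<Longrightarrow> s \<ge> l \<and> \<phi> s \<in> ?Y + K \<and> (\<exists>t \<in> ?S. t < l \<and> \<phi> t = \<phi> s)"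
      and ab: "a \<in> A" "b \<in> B" "\<phi> (a + b) \<notin> ?Y + K" for V a b
    unfolding K_def
  proof (rule card_sumset_ge_fibre[OF fin V(1) _ ab(1,2)])
    fix s assume s: "s \<in> V"
    show "\<exists>t \<in> ?S - V. \<phi> t = \<phi> s" using V(2)[OF s] V(2) by (metis DiffI linorder_not_less)
    show "\<phi> s - \<phi> (a + b) \<notin> stabilizer (\<phi> ` ?S)"
    proof
      assume "\<phi> s - \<phi> (a + b) \<in> stabilizer (\<phi> ` ?S)"
      then have "\<phi> (a + b) + (\<phi> s - \<phi> (a + b)) \<in> ?Y + K \<longleftrightarrow> \<phi> (a + b) \<in> ?Y + K"
        by (intro closed) (simp add: K_def)
      then show False using V(2)[OF s] ab(3) by simp
    qed
  qed
  show ?thesis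
  proof (cases "\<exists>a \<in> A. \<exists>b \<in> B. \<phi> (a + b) \<notin> ?Y + K")
    case False
    \<comment> \<open>Here Kneser's bound forces all residues of \<open>A\<close> into
      \<open>K\<close>. Then \<open>B\<close> cannot stay in \<open>K\<close>, and its parts inside
      and outside \<open>K\<close> have disjoint sums with \<open>A\<close>, which yields the first
      alternative.\<close>
    have "\<phi> ` ?S \<subseteq> ?Y + K" using False by (auto elim!: set_plus_elim)
    then have "card (\<phi> ` ?S) \<le> card (?Y + K)" using fXK by (intro card_mono)
    then have "card (?X + K) \<le> ?k" using kn by linarith
    moreover have "K \<subseteq> ?X + K" using X0 by (rule set_zero_plus2)
    ultimately have "K = ?X + K" using fXK by (intro card_seteq) auto
    then have XK: "\<phi> a \<in> K" if "a \<in> A" for a using subK[of ?X] that by auto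
    define B1 where "B1 = {b \<in> B. \<phi> b \<in> K}"
    define B2 where "B2 = {b \<in> B. \<phi> b \<notin> K}"
    have "B2 \<noteq> {}"
    proof
      assume "B2 = {}"
      then have "\<phi> x \<in> K" if "x \<in> A \<union> B" for x using XK that by (auto simp: B2_def)
      then have "range \<phi> \<subseteq> K" using residues_in_subgroup[OF K, of "A \<union> B"] gcd by blast
      moreover have "K \<subseteq> \<phi> ` ?S"
      proof
        fix t assume "t \<in> K"
        then have "t + \<phi> 0 \<in> \<phi> ` ?S" unfolding K_def using S0 by (subst stabilizer_add_iff) blast+
        then show "t \<in> \<phi> ` ?S" by simp
      qed
      ultimately show False using nc by auto
    qed
    moreover have "B1 \<noteq> {}" using 0 K by (auto simp: B1_def intro!: exI[of _ 0])
    moreover have fB: "finite B1" "finite B2" using fin by (auto simp: B1_def B2_def)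
    ultimately have "card A + card B1 \<le> card (A + B1) + 1" "card A + card B2 \<le> card (A + B2) + 1"
      using fin ne by (simp_all only: card_sumset_ge simp_thms)
    moreover have "card (A + B1) + card (A + B2) \<le> card ?S"
    proof -
      have "(A + B1) \<inter> (A + B2) = {}"
      proof (rule ccontr)
        assume "(A + B1) \<inter> (A + B2) \<noteq> {}"
        then obtain s where "s \<in> A + B1" "s \<in> A + B2" by blast
        then obtain a b a' b' where ab: "a \<in> A" "b \<in> B1" "a' \<in> A" "b' \<in> B2" "a + b = a' + b'"
          by (metis set_plus_elim)
        then have "\<phi> a + \<phi> b = \<phi> a' + \<phi> b'" by (metis add)
        then have "\<phi> b' = (\<phi> a + \<phi> b) - \<phi> a'" by simp
        also have "\<dots> \<in> K" using ab XK K Kd by (simp add: B1_def)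
        finally show False using ab by (simp add: B2_def)
      qed
      then have "card (A + B1) + card (A + B2) = card ((A + B1) \<union> (A + B2))"
        using fin fB by (intro card_Un_disjoint[symmetric] finite_set_plus)
      also have "\<dots> \<le> card ?S"
        using fS by (intro card_mono Un_least set_plus_mono2) (auto simp: B1_def B2_def)
      finally show ?thesis .
    qed
    moreover have "card B = card B1 + card B2"
    proof -
      have "B = B1 \<union> B2" "B1 \<inter> B2 = {}" by (auto simp: B1_def B2_def)
      then show ?thesis using fB card_Un_disjoint by metis
    qed
    ultimately show ?thesis by linarith
  next
    case True
    then obtain a b where ab: "a \<in> A" "b \<in> B" "\<phi> (a + b) \<notin> ?Y + K" by blast
    \<comment> \<open>Combining \<open>bound\<close> with the hole bounds of both fibres and
      Kneser's bound cancels every \<open>?k\<close>.\<close>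
    have main: "card V + card ?X + card ?Y \<le> card ?S + 1"
      if V: "V \<subseteq> ?S" "\<And>s. s \<in> V \<Longrightarrow> s \<ge> l \<and> \<phi> s \<in> ?Y + K \<and> (\<exists>t \<in> ?S. t < l \<and> \<phi> t = \<phi> s)" for V
      using bound[OF V ab] hole[OF ab(1) fin(1)] hole[OF ab(2) fin(2)] kn by linarith
    have mainW: "card B + card ?X + card ?Y \<le> card ?S + 1"
      unfolding cW[symmetric] using WS Wge WY Wrep by (intro main) auto
    \<comment> \<open>Passing from residues back to elements costs one for \<open>A\<close>, and one
      for \<open>B\<close> when \<open>l \<in> B\<close>. A unit has to be regained only if also
      \<open>A\<close> is not contained in \<open>B\<close>.\<close>
    show ?thesis
    proof (cases "l \<in> B \<and> \<not> A \<subseteq> B")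
      case False
      then show ?thesis using mainW cX cY by (auto split: if_splits)
    next
      case lB: True
      show ?thesis
      proof (cases "\<exists>x \<in> A. \<phi> x \<in> ?Y + K \<and> \<phi> x \<notin> ?Y")
        case True
        \<comment> \<open>The unit comes from \<open>x + l\<close>: it repeats the residue of
          \<open>x\<close>, and it is not in \<open>W\<close> because that residue is not in
          \<open>?Y\<close>.\<close>
        then obtain x where x: "x \<in> A" "\<phi> x \<in> ?Y + K" "\<phi> x \<notin> ?Y" by blast
        have xl: "x \<noteq> l" using x(3) Y0 by auto
        have xS: "x + l \<in> ?S" "x + 0 \<in> ?S" using x lB 0 by (auto intro!: set_plus_intro simp del: add_0_right)
        have "\<phi> (x + l) \<notin> \<phi> ` W" using x(3) by (auto simp: W_def add image_iff)
        then have "x + l \<notin> W" by blast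
        then have "card (insert (x + l) W) = card B + 1" using fin by (simp add: W_def cW[unfolded W_def])
        moreover have "card (insert (x + l) W) + card ?X + card ?Y \<le> card ?S + 1"
        proof (rule main)
          show "insert (x + l) W \<subseteq> ?S" using WS xS by auto
          fix s assume "s \<in> insert (x + l) W"
          then show "s \<ge> l \<and> \<phi> s \<in> ?Y + K \<and> (\<exists>t \<in> ?S. t < l \<and> \<phi> t = \<phi> s)"
          proof
            assume s: "s = x + l"
            have "x \<in> ?S \<and> x < l \<and> \<phi> x = \<phi> s" using xS s x(1) xl A by (force simp: add)
            moreover have "\<phi> s \<in> ?Y + K" using s x(2) by (simp add: add)
            ultimately show ?thesis using s A x(1) by auto
          qed (use Wge WY Wrep in auto)
        qed
        ultimately show ?thesis using lB cX cY by auto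
      next
        case False
        \<comment> \<open>The fibre of \<open>B\<close> over \<open>K\<close> now contains that of
          \<open>A\<close>, in which \<open>0\<close> and \<open>l\<close> share a residue; this
          supplies the unit. Both fibres are measured through \<open>A\<close>, so the holes of
          \<open>?X\<close> are counted in \<open>K\<close> and in the coset of \<open>x\<close> at
          once.\<close>
        obtain x where x: "x \<in> A" "x \<notin> B" using lB by blast
        have AB: "y \<in> B" if y: "y \<in> A" "\<phi> y \<in> ?Y + K" for y
        proof -
          have "\<phi> y \<in> ?Y" using False y by blast
          then obtain b where b: "b \<in> B" "\<phi> y = \<phi> b" by auto
          then have "l dvd y - b" by (simp add: eq_iff)
          moreover have "\<bar>y - b\<bar> \<le> l" using y b A B by (force simp: abs_le_iff)
          ultimately have "y = b \<or> \<bar>y - b\<bar> = l" using l_pos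
            by (metis abs_0_eq abs_ge_zero dvd_abs_iff eq_iff_diff_eq_0 order_antisym order_le_less zdvd_imp_le)
          moreover have "y \<in> {0..l}" "b \<in> {0..l}" using y b A B by auto
          ultimately have "y = b \<or> y = 0 \<or> y = l" by auto
          then show ?thesis using b 0 lB by auto
        qed
        have x': "\<phi> (x + 0) \<notin> ?Y + K" using AB[OF x(1)] x(2) by auto
        let ?P = "{y \<in> A. \<phi> y - \<phi> x \<in> K}" and ?Q = "{y \<in> A. \<phi> y \<in> K}"
        have KY: "K \<subseteq> ?Y + K" using Y0 by (rule set_zero_plus2)
        have "card W + card (\<phi> ` ?S) + card ?P + card {y \<in> B. \<phi> y - \<phi> 0 \<in> K} \<le> card ?S + ?k + 1"
          using WS Wge WY Wrep x(1) 0(3) x' by (intro bound) auto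
        moreover have "card ?Q \<le> card {y \<in> B. \<phi> y - \<phi> 0 \<in> K}"
          using fin AB KY by (intro card_mono) auto
        moreover have "card (\<phi> ` ?Q) + 1 \<le> card ?Q"
        proof -
          have "\<phi> ` ?Q \<subseteq> \<phi> ` (?Q - {l})"
          proof
            fix z assume "z \<in> \<phi> ` ?Q"
            then obtain y where y: "y \<in> ?Q" "z = \<phi> y" by auto
            show "z \<in> \<phi> ` (?Q - {l})"
            proof (cases "y = l")
              case True
              then have "z = \<phi> 0" using y by simp
              then show ?thesis using 0 K l_pos by (intro image_eqI[of _ _ 0]) auto
            qed (use y in auto)
          qed
          then have "card (\<phi> ` ?Q) \<le> card (\<phi> ` (?Q - {l}))" using fin by (intro card_mono) auto
          also have "\<dots> \<le> card (?Q - {l})" using fin by (intro card_image_le) auto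
          also have "\<dots> < card ?Q" using fin 0 K by (intro psubset_card_mono) auto
          finally show ?thesis by simp
        qed
        moreover have "card ?X + 2 * ?k \<le> card (\<phi> ` ?Q) + card ?P + card (?X + K)"
        proof -
          let ?C = "(+) (\<phi> x) ` K"
          have disj: "K \<inter> ?C = {}"
          proof (rule ccontr)
            assume "K \<inter> ?C \<noteq> {}"
            then obtain k where "k \<in> K" "\<phi> x + k \<in> K" by auto
            then have "(\<phi> x + k) - k \<in> K" by (intro Kd)
            then show False using x' KY by auto
          qed
          have "K \<union> ?C \<subseteq> ?X + K"
            using coset[OF x(1)] coset[OF 0(1)] by simp
          then have "card ?X + card (K \<union> ?C) \<le> card (?X \<inter> (K \<union> ?C)) + card (?X + K)"
            using fin by (intro part) auto
          moreover have "card (K \<union> ?C) = 2 * ?k"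
            using disj fK card_translate[of "\<phi> x" K] by (simp add: card_Un_disjoint)
          moreover have "card (?X \<inter> (K \<union> ?C)) \<le> card (?X \<inter> K) + card (?X \<inter> ?C)"
            by (metis Int_Un_distrib card_Un_le)
          moreover have "card (?X \<inter> K) = card (\<phi> ` ?Q)" by (rule arg_cong[where f = card]) auto
          moreover note fibre[OF fin(1), of x]
          ultimately show ?thesis by linarith
        qed
        moreover have "card ?Y \<le> card (?Y + K)" using fXK subK by (intro card_mono)
        ultimately show ?thesis using kn cW cX cY lB by auto
      qed
    qed
  qed
qed

text \<open>If all residues are hit, the repeated ones give
  \<open>card B + l \<le> card (A + B)\<close>. Otherwise smallness contradicts the preceding lemma
  unless \<open>l \<in> B\<close> and \<open>A\<close> is strictly inside \<open>B\<close>; in that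
  case the lemma with the two sets exchanged gives the contradiction.\<close>

lemma length_le_of_small_sumset:
  assumes A: "A \<subseteq> {0..l}" and B: "B \<subseteq> {0..l}" and 0: "0 \<in> A" "l \<in> A" "0 \<in> B"
    and gcd: "\<And>d. (\<And>x. x \<in> A \<union> B \<Longrightarrow> d dvd x) \<Longrightarrow> d dvd 1"
    and small: "card (A + B) + 3 \<le> card A + card B + min (card A) (card B)"
    and small_eq: "A = B \<Longrightarrow> card (A + B) + 4 \<le> 3 * card A"
  shows "l + 3 \<le> int (card A + card B)"
proof (cases "\<phi> ` (A + B) = range \<phi>")
  case True
  have "finite A" using A finite_subset by blast
  then have "card B + nat l \<le> card (A + B)"
    using card_sumset_ge_residues[OF _ B 0] True card_range by simp
  then show ?thesis using small l_pos by linarith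
next
  case False
  note ls = card_sumset_ge_not_covering[OF A B 0 gcd False]
  have fB: "finite B" using B finite_subset by blast
  have "l \<in> B \<and> A \<subset> B"
  proof (rule ccontr)
    assume "\<not> (l \<in> B \<and> A \<subset> B)"
    then have "A = B \<or> \<not> (l \<in> B \<and> A \<subseteq> B)" by blast
    then show False using ls small small_eq by (auto split: if_splits)
  qed
  then have lB: "l \<in> B" "A \<subset> B" by auto
  then have "\<not> (l \<in> A \<and> B \<subseteq> A)" by blast
  moreover have "2 * card B + card A \<le> card (B + A) + 2 \<or>
      card B + 2 * card A \<le> card (B + A) + (if l \<in> A \<and> B \<subseteq> A then 3 else 2)"
    using False gcd
    by (intro card_sumset_ge_not_covering A B 0 lB(1)) (auto simp: Un_commute add.commute)
  ultimately show ?thesis using small by (auto simp: add.commute split: if_splits)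
qed

end

lemma length_le_of_small_sumset:
  fixes A B :: "int set" and l :: int
  assumes l: "l > 0" and A: "A \<subseteq> {0..l}" and B: "B \<subseteq> {0..l}"
    and 0: "0 \<in> A" "l \<in> A" "0 \<in> B"
    and gcd: "\<And>d. (\<And>x. x \<in> A \<union> B \<Longrightarrow> d dvd x) \<Longrightarrow> d dvd 1"
    and small: "card (A + B) + 3 \<le> card A + card B + min (card A) (card B)"
    and small_eq: "A = B \<Longrightarrow> card (A + B) + 4 \<le> 3 * card A"
  shows "l + 3 \<le> int (card A + card B)"
proof -
  obtain \<phi> :: "int \<Rightarrow> circle" where "mod_hom \<phi> l"
    using exists_hom_kernel_multiples[OF l] l by (auto simp: mod_hom_def)
  from mod_hom.length_le_of_small_sumset[OF this A B 0 gcd small small_eq] show ?thesis .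
qed

section \<open>Gaps in sumsets of dense sets\<close>

text \<open>Falling by at most one per step, \<open>f\<close> must leave each level above
  \<open>max 1 (f z)\<close> and up to \<open>f y\<close> by a unit descent.\<close>

lemma card_descents_ge:
  fixes f :: "int \<Rightarrow> int"
  assumes "y \<le> z" and "\<And>x. y < x \<Longrightarrow> x \<le> z \<Longrightarrow> f (x - 1) - 1 \<le> f x"
  shows "f y - max 1 (f z) \<le> int (card {x \<in> {y<..z}. f x = f (x - 1) - 1 \<and> 2 \<le> f (x - 1)})"
  using assms
proof (induction z rule: int_ge_induct)
  case base
  then show ?case by simp
next
  case (step z)
  let ?D = "\<lambda>z. {x \<in> {y<..z}. f x = f (x - 1) - 1 \<and> 2 \<le> f (x - 1)}"
  have IH: "f y - max 1 (f z) \<le> int (card (?D z))" using step by auto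
  have st: "f z - 1 \<le> f (z + 1)" using step.prems[of "z + 1"] step.hyps by simp
  have fin: "finite (?D z)" for z by (rule finite_subset[of _ "{y<..z}"]) auto
  show ?case
  proof (cases "f (z + 1) = f z - 1 \<and> 2 \<le> f z")
    case True
    then have "?D (z + 1) = insert (z + 1) (?D z)" using step.hyps by force
    then have "card (?D (z + 1)) = card (?D z) + 1" using fin by simp
    then show ?thesis using IH True by simp
  next
    case False
    have "card (?D z) \<le> card (?D (z + 1))" using fin by (intro card_mono) auto
    then show ?thesis using IH False st by linarith
  qed
qed

lemma atMost_int_eq_insert: "{..x} = insert x {..x - 1 :: int}"
  by auto

lemma card_Int_atMost_diff:
  fixes A :: "int set"
  assumes "finite A" "x \<le> y"
  shows "int (card (A \<inter> {..y})) = int (card (A \<inter> {..x})) + int (card (A \<inter> {x<..y}))"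
    and "int (card (A \<inter> {..y})) \<le> int (card (A \<inter> {..x})) + (y - x)"
proof -
  have "A \<inter> {..y} = (A \<inter> {..x}) \<union> (A \<inter> {x<..y})" using assms by auto
  moreover have "(A \<inter> {..x}) \<inter> (A \<inter> {x<..y}) = {}" by auto
  ultimately show *: "int (card (A \<inter> {..y})) = int (card (A \<inter> {..x})) + int (card (A \<inter> {x<..y}))"
    using assms by (simp add: card_Un_disjoint)
  have "card (A \<inter> {x<..y}) \<le> card {x<..y}" by (intro card_mono) auto
  then have "int (card (A \<inter> {x<..y})) \<le> y - x" using assms by simp
  then show "int (card (A \<inter> {..y})) \<le> int (card (A \<inter> {..x})) + (y - x)" using * by simp
qed

text \<open>Pigeonhole: \<open>A\<close> and the reflection \<open>s - B\<close> are disjoint, and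
  the window contains all of the latter.\<close>

lemma card_Int_le_of_not_in_sumset:
  fixes A B :: "int set"
  assumes s: "s \<notin> A + B" and fin: "finite A" "finite B" and B: "\<And>b. b \<in> B \<Longrightarrow> i \<le> s - b \<and> s - b \<le> j"
  shows "card (A \<inter> {i..j}) + card B \<le> card {i..j}"
proof -
  have "A \<inter> {i..j} \<inter> (-) s ` B = {}"
  proof (rule ccontr)
    assume "A \<inter> {i..j} \<inter> (-) s ` B \<noteq> {}"
    then obtain b where "b \<in> B" "s - b \<in> A" by auto
    then have "(s - b) + b \<in> A + B" by (intro set_plus_intro)
    then show False using s by simp
  qed
  then have "card (A \<inter> {i..j}) + card ((-) s ` B) = card (A \<inter> {i..j} \<union> (-) s ` B)"
    using fin by (intro card_Un_disjoint[symmetric]) auto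
  also have "\<dots> \<le> card {i..j}" using B by (intro card_mono) auto
  also have "card ((-) s ` B) = card B" by (rule card_image) (auto simp: inj_on_def)
  finally show ?thesis .
qed

locale dense_pair =
  fixes A B :: "int set" and l m :: int
  assumes A: "A \<subseteq> {0..l}" and B: "B \<subseteq> {0..m}" and ml: "m \<le> l"
    and mem: "0 \<in> A" "l \<in> A" "0 \<in> B" "m \<in> B"
    and dense: "l + 3 \<le> int (card A + card B)"
begin

text \<open>
  By \<open>middle\<close> below, the gaps of \<open>A + B\<close> in \<open>{0..l + m}\<close> are the low gaps and the high gaps, the
  latter being recorded after subtracting \<open>l\<close>.
\<close>

definition low_gaps :: "int set" where "low_gaps = {x \<in> {0..m}. x \<notin> A + B}"
definition high_gaps :: "int set" where "high_gaps = {x \<in> {0..m}. x + l \<notin> A + B}"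

text \<open>The pigeonhole surplus of \<open>{0..x}\<close>: for \<open>x\<close> in
  \<open>{0..m}\<close>, a positive value puts \<open>x\<close> into \<open>A + B\<close>.\<close>

definition excess :: "int \<Rightarrow> int" where
  "excess x = int (card (A \<inter> {..x})) + int (card (B \<inter> {..x})) - (x + 1)"

lemma fin: "finite A" "finite B" "finite (A + B)"
  using A B finite_subset finite_set_plus by blast+

lemma fin_gaps: "finite low_gaps" "finite high_gaps"
  by (rule finite_subset[of _ "{0..m}"]; auto simp: low_gaps_def high_gaps_def)+

lemma sumset_subset: "A + B \<subseteq> {0..l + m}"
  using A B by (force elim!: set_plus_elim)

lemma A_subset: "A \<subseteq> A + B" and B_subset: "B \<subseteq> A + B"
  using set_zero_plus2 mem by (metis add.commute)+

lemma l_plus_B: "b \<in> B \<Longrightarrow> b + l \<in> A + B"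
  using mem by (metis add.commute set_plus_intro)

lemma low_gaps_notin: "x \<in> low_gaps \<Longrightarrow> x \<notin> A \<and> x \<notin> B"
  using A_subset B_subset by (auto simp: low_gaps_def)

lemma high_gaps_notin: "x \<in> high_gaps \<Longrightarrow> x + l - m \<notin> A \<and> x \<notin> B"
proof -
  have "x + l \<in> A + B" if "x + l - m \<in> A"
    using set_plus_intro[OF that mem(4)] by simp
  then show "x \<in> high_gaps \<Longrightarrow> x + l - m \<notin> A \<and> x \<notin> B"
    using l_plus_B by (auto simp: high_gaps_def)
qed

lemma low_gap_count:
  assumes "x \<in> low_gaps"
  shows "excess x \<le> 0"
proof -
  have x: "0 \<le> x" "x \<notin> A + B" using assms by (auto simp: low_gaps_def)
  have "card (A \<inter> {0..x}) + card (B \<inter> {..x}) \<le> card {0..x}"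
  proof (rule card_Int_le_of_not_in_sumset)
    show "x \<notin> A + (B \<inter> {..x})" using x(2) set_plus_mono2[of A A "B \<inter> {..x}" B] by blast
  qed (use fin B in auto)
  moreover have "A \<inter> {..x} = A \<inter> {0..x}" using A by auto
  ultimately show ?thesis using x by (simp add: excess_def)
qed

lemma high_gap_count:
  assumes "x \<in> high_gaps"
  shows "int (card A + card B) \<le> int (card (A \<inter> {..x + l - m - 1})) + int (card (B \<inter> {..x - 1})) + (m - x + 1)"
proof -
  have x: "0 \<le> x" "x \<le> m" "x + l \<notin> A + B" using assms by (auto simp: high_gaps_def)
  have "card (A \<inter> {x + l - m..l}) + card (B \<inter> {x..}) \<le> card {x + l - m..l}"
  proof (rule card_Int_le_of_not_in_sumset)
    show "x + l \<notin> A + (B \<inter> {x..})" using x(3) set_plus_mono2[of A A "B \<inter> {x..}" B] by blast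
  qed (use fin B in auto)
  moreover have "card A = card (A \<inter> {..x + l - m - 1}) + card (A \<inter> {x + l - m..l})"
  proof -
    have "A = (A \<inter> {..x + l - m - 1}) \<union> (A \<inter> {x + l - m..l})" using A by force
    moreover have "(A \<inter> {..x + l - m - 1}) \<inter> (A \<inter> {x + l - m..l}) = {}" by auto
    ultimately show ?thesis using fin card_Un_disjoint by (metis finite_Int)
  qed
  moreover have "card B = card (B \<inter> {..x - 1}) + card (B \<inter> {x..})"
  proof -
    have "B = (B \<inter> {..x - 1}) \<union> (B \<inter> {x..})" by force
    moreover have "(B \<inter> {..x - 1}) \<inter> (B \<inter> {x..}) = {}" by auto
    ultimately show ?thesis using fin card_Un_disjoint by (metis finite_Int)
  qed
  ultimately show ?thesis using x by simp
qed

text \<open>The count at a high gap speaks of \<open>A\<close> up to \<open>x + l - m - 1\<close>;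
  the window from \<open>x\<close> to there adds at most \<open>l - m\<close> elements. If it is
  nonempty and \<open>x\<close> is not in \<open>A\<close>, one place is wasted and the bound
  improves by one.\<close>

lemma high_gap_excess:
  assumes "x \<in> high_gaps"
  shows "int (card A + card B) - l - 1 \<le> excess (x - 1)"
    and "m < l \<Longrightarrow> x \<notin> A \<Longrightarrow> int (card A + card B) - l \<le> excess (x - 1)"
proof -
  note h = high_gap_count[OF assms]
  have "int (card (A \<inter> {..x + l - m - 1})) \<le> int (card (A \<inter> {..x - 1})) + (l - m)"
    using card_Int_atMost_diff(2)[OF fin(1), of "x - 1" "x + l - m - 1"] ml by simp
  then show "int (card A + card B) - l - 1 \<le> excess (x - 1)" using h by (simp add: excess_def)
  assume a: "m < l" "x \<notin> A"
  have "int (card (A \<inter> {..x + l - m - 1})) \<le> int (card (A \<inter> {..x})) + (l - m - 1)"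
    using card_Int_atMost_diff(2)[OF fin(1), of x "x + l - m - 1"] a by simp
  moreover have "A \<inter> {..x} = A \<inter> {..x - 1}" using a by (simp add: atMost_int_eq_insert[of x])
  ultimately show "int (card A + card B) - l \<le> excess (x - 1)" using h by (simp add: excess_def)
qed

lemma excess_step: "excess x = excess (x - 1) + of_bool (x \<in> A) + of_bool (x \<in> B) - 1"
proof -
  have "int (card (M \<inter> {..x})) = int (card (M \<inter> {..x - 1})) + of_bool (x \<in> M)" if "finite M" for M :: "int set"
  proof -
    have "M \<inter> {..x} = (if x \<in> M then insert x (M \<inter> {..x - 1}) else M \<inter> {..x - 1})"
      by (simp add: atMost_int_eq_insert[of x])
    then show ?thesis using that by auto
  qed
  then show ?thesis using fin by (simp add: excess_def)
qed

text \<open>For a missing \<open>x\<close>, the pigeonhole count in \<open>{x - m..x}\<close>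
  together with the trivial count of \<open>A\<close> outside this window would give
  \<open>|A| + |B| \<le> l + 1\<close>.\<close>

lemma middle: "m \<le> x \<Longrightarrow> x \<le> l \<Longrightarrow> x \<in> A + B"
proof (rule ccontr)
  assume x: "m \<le> x" "x \<le> l" "x \<notin> A + B"
  have m0: "m \<ge> 0" using B mem by auto
  have "card (A \<inter> {x - m..x}) + card B \<le> card {x - m..x}"
    using x fin B by (intro card_Int_le_of_not_in_sumset) auto
  moreover have "card A \<le> card (A \<inter> {x - m..x}) + card ({0..l} - {x - m..x})"
  proof -
    have "card A = card (A \<inter> {x - m..x}) + card (A - {x - m..x})" using fin by (intro card_Int_Diff)
    moreover have "card (A - {x - m..x}) \<le> card ({0..l} - {x - m..x})" using A by (intro card_mono) auto
    ultimately show ?thesis by linarith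
  qed
  moreover have "card ({0..l} - {x - m..x}) = card {0..l} - card {x - m..x}"
    using x by (intro card_Diff_subset) auto
  ultimately have "int (card A + card B) \<le> l + 1" using x m0 by (auto simp: of_nat_diff)
  then show False using dense by simp
qed

text \<open>At a common gap the walk would fall from at least 2 to at most 0 in a single
  step.\<close>

lemma gaps_disjoint: "low_gaps \<inter> high_gaps = {}"
proof (rule ccontr)
  assume "low_gaps \<inter> high_gaps \<noteq> {}"
  then obtain x where x: "x \<in> low_gaps" "x \<in> high_gaps" by auto
  show False
    using low_gap_count[OF x(1)] high_gap_excess(1)[OF x(2)] excess_step[of x] dense by (auto simp: of_bool_def split: if_splits)
qed

lemma card_sumset: "int (card (A + B)) = l + m + 1 - int (card low_gaps) - int (card high_gaps)"
proof -
  have m0: "m \<ge> 0" "l \<ge> 0" using A B mem by auto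
  have "{0..l + m} - (A + B) = low_gaps \<union> (\<lambda>x. x + l) ` high_gaps"
  proof (intro equalityI subsetI)
    fix x assume x: "x \<in> {0..l + m} - (A + B)"
    moreover have "m \<le> x \<Longrightarrow> x \<le> l \<Longrightarrow> x \<in> A + B" by (rule middle)
    ultimately consider "x \<le> m" | "x \<ge> l" by fastforce
    then show "x \<in> low_gaps \<union> (\<lambda>x. x + l) ` high_gaps"
    proof cases
      case 1
      then show ?thesis using x by (auto simp: low_gaps_def)
    next
      case 2
      then have "x - l \<in> high_gaps" using x by (auto simp: high_gaps_def)
      then show ?thesis by (intro UnI2 image_eqI[of _ _ "x - l"]) auto
    qed
  qed (use ml m0 in \<open>auto simp: low_gaps_def high_gaps_def\<close>)
  moreover have "low_gaps \<inter> (\<lambda>x. x + l) ` high_gaps = {}"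
  proof -
    have "x < m" if "x \<in> low_gaps" for x
      using that middle[of m] ml by (auto simp: low_gaps_def order_le_less)
    moreover have "l \<le> x" if "x \<in> (\<lambda>x. x + l) ` high_gaps" for x
      using that by (auto simp: high_gaps_def)
    ultimately show ?thesis using ml by force
  qed
  moreover have "card ((\<lambda>x. x + l) ` high_gaps) = card high_gaps"
    by (rule card_image) (auto simp: inj_on_def)
  ultimately have "card ({0..l + m} - (A + B)) = card low_gaps + card high_gaps"
    using fin_gaps by (simp add: card_Un_disjoint)
  moreover have "card ({0..l + m} - (A + B)) = card {0..l + m} - card (A + B)"
    using fin sumset_subset by (intro card_Diff_subset) auto
  moreover have "card (A + B) \<le> card {0..l + m}" using sumset_subset by (intro card_mono) auto
  ultimately show ?thesis using m0 by (simp add: of_nat_diff)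
qed

text \<open>
  The walk \<open>excess\<close> has steps in \<open>{-1, 0, 1}\<close>; it is at least \<open>w = |A| + |B| - l - 1 \<ge> 2\<close> just before a
  high gap and at most \<open>0\<close> at a low gap. If a low gap follows a high gap, then the walk descends in between
  through all levels from \<open>w - 1\<close> to \<open>1\<close>, and the positions of these descents are outside \<open>A\<close> and \<open>B\<close>
  without being gaps. This leaves room for too few gaps.
\<close>

lemma low_gaps_less_high_gaps:
  assumes small: "card (A + B) + 3 \<le> card A + card B + min (card A) (card B)"
    and small_eq: "A = B \<Longrightarrow> card (A + B) + 4 \<le> 3 * card A"
    and z: "z \<in> low_gaps" and y0: "y0 \<in> high_gaps"
  shows "z < y0"
proof (rule ccontr)
  assume "\<not> z < y0"
  moreover have "z \<noteq> y0" using z y0 gaps_disjoint by auto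
  ultimately have y0z: "y0 < z" by simp
  \<comment> \<open>Taking the last high gap \<open>y\<close> before \<open>z\<close> ensures that
    no descent in between is a high gap. A descent counted in \<open>D\<close> ends at a positive
    level, so it is no low gap either.\<close>
  define Y where "Y = {y \<in> high_gaps. y < z}"
  have Y: "finite Y" "Y \<noteq> {}" using fin_gaps y0 y0z by (auto simp: Y_def)
  define y where "y = Max Y"
  have "y \<in> Y" unfolding y_def using Y by (rule Max_in)
  then have y: "y \<in> high_gaps" "y < z" by (auto simp: Y_def)
  have ymax: "x \<notin> high_gaps" if "y < x" "x < z" for x
  proof
    assume "x \<in> high_gaps"
    then have "x \<le> y" unfolding y_def using Y that by (intro Max_ge) (auto simp: Y_def)
    then show False using that by simp
  qed
  define w where "w = int (card A + card B) - l - 1"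
  define D where "D = {x \<in> {y<..z - 1}. excess x = excess (x - 1) - 1 \<and> 2 \<le> excess (x - 1)}"
  have "excess z = excess (z - 1) - 1" using excess_step[of z] low_gaps_notin[OF z] by simp
  then have z1: "excess (z - 1) \<le> 1" using low_gap_count[OF z] by simp
  have "excess y - max 1 (excess (z - 1)) \<le> int (card D)"
    unfolding D_def using y
  proof (intro card_descents_ge)
    fix x show "excess (x - 1) - 1 \<le> excess x" using excess_step[of x] by simp
  qed simp
  then have D1: "excess y - 1 \<le> int (card D)" using z1 by simp
  have y1: "w \<le> excess (y - 1)" using high_gap_excess(1)[OF y(1)] by (simp add: w_def)
  then have yw: "w - 1 \<le> excess y" using excess_step[of y] by simp
  \<comment> \<open>If \<open>y \<in> A\<close>, the walk does not fall at \<open>y\<close>; if not,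
    the sharper bound of \<open>high_gap_excess\<close> compensates for the fall.\<close>
  have yw': "w \<le> excess y" if "m < l"
  proof (cases "y \<in> A")
    case True
    then show ?thesis using y1 excess_step[of y] by simp
  next
    case False
    then show ?thesis
      using high_gap_excess(2)[OF y(1) that] excess_step[of y] by (simp add: w_def)
  qed
  have D_notin: "x \<notin> A \<and> x \<notin> B" if "x \<in> D" for x
    using that excess_step[of x] by (auto simp: D_def of_bool_def split: if_splits)
  have D_gaps: "D \<inter> (low_gaps \<union> high_gaps) = {}"
    using ymax low_gap_count by (force simp: D_def)
  have fD: "finite D" unfolding D_def by (rule finite_subset[of _ "{y<..z - 1}"]) auto
  have Dm: "D \<subseteq> {0..m}" using y z by (auto simp: D_def low_gaps_def high_gaps_def)
  have cU: "card (low_gaps \<union> high_gaps \<union> D) = card low_gaps + card high_gaps + card D"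
    using fin_gaps fD gaps_disjoint D_gaps by (subst card_Un_disjoint; auto simp: card_Un_disjoint)
  have count: "int (card low_gaps + card high_gaps + card D) \<le> m + 1 - int (card M)"
    if "M \<subseteq> {0..m}" "\<And>x. x \<in> low_gaps \<union> high_gaps \<union> D \<Longrightarrow> x \<notin> M" for M
  proof -
    have "finite M" using that(1) finite_subset by blast
    have "low_gaps \<union> high_gaps \<union> D \<subseteq> {0..m} - M"
      using Dm that(2) by (auto simp: low_gaps_def high_gaps_def)
    then have "card (low_gaps \<union> high_gaps \<union> D) \<le> card ({0..m} - M)" by (intro card_mono) auto
    also have "\<dots> = card {0..m} - card M" using that \<open>finite M\<close> by (intro card_Diff_subset)
    finally show ?thesis using cU card_mono[OF _ that(1)] mem B by (auto simp: of_nat_diff)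
  qed
  have countB: "int (card low_gaps + card high_gaps + card D) \<le> m + 1 - int (card B)"
    using B low_gaps_notin high_gaps_notin D_notin by (intro count) auto
  show False
  proof (cases "m < l")
    case True
    then show False
      using countB card_sumset D1 yw' small by (simp add: w_def)
  next
    case False
    \<comment> \<open>With only \<open>w - 1 \<le> excess y\<close>, the count ends one short.
      Counting against \<open>A \<union> B\<close> recovers the unit unless
      \<open>A \<subseteq> B\<close>, which leads to \<open>A = B\<close>, where
      \<open>small_eq\<close> provides it.\<close>
    then have lm: "l = m" using ml by simp
    have countAB: "int (card low_gaps + card high_gaps + card D) \<le> m + 1 - int (card (A \<union> B))"
      using A B lm low_gaps_notin high_gaps_notin D_notin by (intro count) auto
    have "A \<subseteq> B"
    proof (rule ccontr)
      assume "\<not> A \<subseteq> B"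
      then have "card B < card (A \<union> B)" using fin by (intro psubset_card_mono) auto
      then show False using countAB card_sumset D1 yw small lm by (simp add: w_def)
    qed
    moreover have "card B \<le> card A" using countB card_sumset D1 yw small lm by (simp add: w_def)
    ultimately have "A = B" using fin by (intro card_seteq) auto
    then show False using countB card_sumset D1 yw small_eq lm by (simp add: w_def)
  qed
qed

lemma interval_in_sumset:
  assumes small: "card (A + B) + 3 \<le> card A + card B + min (card A) (card B)"
    and small_eq: "A = B \<Longrightarrow> card (A + B) + 4 \<le> 3 * card A"
  shows "\<exists>c. {c..<c + int (card A + card B) - 1} \<subseteq> A + B"
    and "l + int (card B) \<le> int (card (A + B))" and "m + int (card A) \<le> int (card (A + B))"
proof -
  note order = low_gaps_less_high_gaps[OF small small_eq]
  have m0: "m \<ge> 0" using B mem by auto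
  \<comment> \<open>The sentinels \<open>-1\<close> and \<open>m + 1\<close> stand for absent gaps
    and satisfy the same counting inequalities as real ones. Everything strictly between
    \<open>x0\<close> and \<open>x1 + l\<close> is a sum.\<close>
  define x0 where "x0 = Max (insert (-1) low_gaps)"
  define x1 where "x1 = Min (insert (m + 1) high_gaps)"
  have x0_in: "x0 \<in> insert (-1) low_gaps" unfolding x0_def using fin_gaps by (intro Max_in) auto
  have x1_in: "x1 \<in> insert (m + 1) high_gaps" unfolding x1_def using fin_gaps by (intro Min_in) auto
  have x0_ge: "x \<le> x0" if "x \<in> low_gaps" for x unfolding x0_def using fin_gaps that by (intro Max_ge) auto
  have x1_le: "x1 \<le> x" if "x \<in> high_gaps" for x unfolding x1_def using fin_gaps that by (intro Min_le) auto
  have x0_range: "-1 \<le> x0" "x0 \<le> m" using x0_in m0 by (auto simp: low_gaps_def)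
  have x1_range: "0 \<le> x1" "x1 \<le> m + 1" using x1_in m0 by (auto simp: high_gaps_def)
  have x01: "x0 < x1" using x0_in x1_in order m0
    by (auto simp: low_gaps_def high_gaps_def)
  have "excess x0 \<le> 0"
  proof (cases "x0 = -1")
    case True
    have "A \<inter> {..-1} = {}" "B \<inter> {..-1} = {}" using A B by auto
    then show ?thesis using True by (simp add: excess_def)
  qed (use x0_in low_gap_count in auto)
  moreover have "int (card A + card B)
      \<le> int (card (A \<inter> {..x1 + l - m - 1})) + int (card (B \<inter> {..x1 - 1})) + (m - x1 + 1)"
  proof (cases "x1 = m + 1")
    case True
    have "A \<inter> {..l} = A" "B \<inter> {..m} = B" using A B by auto
    then show ?thesis using True by simp
  qed (use x1_in high_gap_count in auto)
  ultimately have len: "int (card A + card B) \<le> l + x1 - x0"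
    using card_Int_atMost_diff(2)[OF fin(1), of x0 "x1 + l - m - 1"]
      card_Int_atMost_diff(2)[OF fin(2), of x0 "x1 - 1"] x01 ml by (simp add: excess_def)
  have "{x0 + 1..<x0 + 1 + int (card A + card B) - 1} \<subseteq> A + B"
  proof
    fix t assume "t \<in> {x0 + 1..<x0 + 1 + int (card A + card B) - 1}"
    then have t: "x0 < t" "t < l + x1" using len by auto
    consider "t \<le> m" | "m \<le> t" "t \<le> l" | "l < t" by linarith
    then show "t \<in> A + B"
    proof cases
      case 1
      then show ?thesis using t x0_ge[of t] x0_range by (auto simp: low_gaps_def)
    next
      case 2
      then show ?thesis by (rule middle)
    next
      case 3
      then show ?thesis using t x1_le[of "t - l"] x1_range by (auto simp: high_gaps_def)
    qed
  qed
  then show "\<exists>c. {c..<c + int (card A + card B) - 1} \<subseteq> A + B" by blast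
  have "low_gaps \<union> high_gaps \<subseteq> {0..m} - B"
    using low_gaps_notin high_gaps_notin by (auto simp: low_gaps_def high_gaps_def)
  then have "card (low_gaps \<union> high_gaps) \<le> card ({0..m} - B)" by (intro card_mono) auto
  also have "\<dots> = card {0..m} - card B" using fin B by (intro card_Diff_subset)
  finally have "int (card low_gaps + card high_gaps) \<le> m + 1 - int (card B)"
    using gaps_disjoint fin_gaps card_mono[OF _ B] m0 by (auto simp: card_Un_disjoint of_nat_diff)
  then show "l + int (card B) \<le> int (card (A + B))" using card_sumset by simp
  \<comment> \<open>Since \<open>m \<in> B\<close>, a high gap \<open>x\<close> excludes
    \<open>x + l - m\<close> from \<open>A\<close>. Shifting upward keeps these places above all low
    gaps.\<close>
  let ?H = "(\<lambda>x. x + l - m) ` high_gaps"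
  have "low_gaps \<union> ?H \<subseteq> {0..l} - A"
    using low_gaps_notin high_gaps_notin ml by (auto simp: low_gaps_def high_gaps_def)
  then have "card (low_gaps \<union> ?H) \<le> card ({0..l} - A)" by (intro card_mono) auto
  also have "\<dots> = card {0..l} - card A" using fin A by (intro card_Diff_subset)
  finally have "int (card (low_gaps \<union> ?H)) \<le> l + 1 - int (card A)"
    using card_mono[OF _ A] m0 ml by (auto simp: of_nat_diff)
  moreover have "low_gaps \<inter> ?H = {}" using order ml by force
  moreover have "card ?H = card high_gaps" by (rule card_image) (auto simp: inj_on_def)
  ultimately have "int (card low_gaps + card high_gaps) \<le> l + 1 - int (card A)"
    using fin_gaps by (simp add: card_Un_disjoint)
  then show "m + int (card A) \<le> int (card (A + B))" using card_sumset by simp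
qed

end

section \<open>Small sumsets of integers\<close>

lemma small_sumset_normalized_le:
  fixes A B :: "int set" and l m :: int
  assumes A: "A \<subseteq> {0..l}" and B: "B \<subseteq> {0..m}" and ml: "m \<le> l"
    and mem: "0 \<in> A" "l \<in> A" "0 \<in> B" "m \<in> B"
    and gcd: "\<And>d. (\<And>x. x \<in> A \<union> B \<Longrightarrow> d dvd x) \<Longrightarrow> d dvd 1"
    and small: "card (A + B) + 3 \<le> card A + card B + min (card A) (card B)"
    and small_eq: "A = B \<Longrightarrow> card (A + B) + 4 \<le> 3 * card A"
  shows "(\<exists>c. {c..<c + int (card A + card B) - 1} \<subseteq> A + B) \<and>
    l + int (card B) \<le> int (card (A + B)) \<and> m + int (card A) \<le> int (card (A + B))"
proof -
  have "l > 0"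
  proof (rule ccontr)
    assume "\<not> l > 0"
    moreover have "l \<ge> 0" "m \<ge> 0" using A B mem by auto
    ultimately have "A = {0}" "B = {0}" using A B mem ml by auto
    then show False using small by simp
  qed
  moreover have "B \<subseteq> {0..l}" using B ml by force
  ultimately have "l + 3 \<le> int (card A + card B)"
    using A mem gcd small small_eq by (intro length_le_of_small_sumset) auto
  then interpret dense_pair A B l m using A B ml mem by unfold_locales auto
  show ?thesis using interval_in_sumset[OF small small_eq] by blast
qed

lemma small_sumset_normalized:
  fixes A B :: "int set" and l m :: int
  assumes A: "A \<subseteq> {0..l}" and B: "B \<subseteq> {0..m}"
    and mem: "0 \<in> A" "l \<in> A" "0 \<in> B" "m \<in> B"
    and gcd: "\<And>d. (\<And>x. x \<in> A \<union> B \<Longrightarrow> d dvd x) \<Longrightarrow> d dvd 1"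
    and small: "card (A + B) + 3 \<le> card A + card B + min (card A) (card B)"
    and small_eq: "A = B \<Longrightarrow> card (A + B) + 4 \<le> 3 * card A"
  shows "(\<exists>c. {c..<c + int (card A + card B) - 1} \<subseteq> A + B) \<and>
    l + int (card B) \<le> int (card (A + B)) \<and> m + int (card A) \<le> int (card (A + B))"
proof (cases "m \<le> l")
  case True
  then show ?thesis using small_sumset_normalized_le assms by blast
next
  case False
  have gcd': "d dvd 1" if "\<And>x. x \<in> B \<union> A \<Longrightarrow> d dvd x" for d using gcd that by blast
  have small': "card (B + A) + 3 \<le> card B + card A + min (card B) (card A)"
    using small by (simp add: add.commute min.commute)
  have small_eq': "card (B + A) + 4 \<le> 3 * card B" if "B = A" using small_eq that by simp
  have "(\<exists>c. {c..<c + int (card B + card A) - 1} \<subseteq> B + A) \<and>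
    m + int (card A) \<le> int (card (B + A)) \<and> l + int (card B) \<le> int (card (B + A))"
    using False by (intro small_sumset_normalized_le B A mem gcd' small' small_eq') auto
  then show ?thesis by (simp add: add.commute)
qed

text \<open>A two-set form of Freiman's \<open>3k - 4\<close> theorem, with a long progression
  inside the sumset. Subtracting the minima and dividing by a gcd reduces it to the normalized case,
  where translates become equal sets.\<close>

theorem small_sumset_int:
  fixes A B :: "int set"
  assumes fin: "finite A" "finite B" and ne: "A \<noteq> {}" "B \<noteq> {}"
    and small: "card (A + B) + 3 \<le> card A + card B + min (card A) (card B)"
    and small_translate: "\<And>t. B = (+) t ` A \<Longrightarrow> card (A + B) + 4 \<le> 3 * card A"
  shows "\<exists>a b c d. A \<subseteq> {a + int i * d |i. i < card (A + B) + 1 - card B} \<and>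
    B \<subseteq> {b + int i * d |i. i < card (A + B) + 1 - card A} \<and>
    {c + int i * d |i. i < card A + card B - 1} \<subseteq> A + B"
proof -
  define a where "a = Min A"
  define b where "b = Min B"
  have ab: "a \<in> A" "b \<in> B" using fin ne by (auto simp: a_def b_def)
  have ab_le: "a \<le> x" if "x \<in> A" for x using fin that by (simp add: a_def)
  have b_le: "b \<le> x" if "x \<in> B" for x using fin that by (simp add: b_def)
  \<comment> \<open>A single gcd over the differences of both sets makes the progressions share
    their difference.\<close>
  define d where "d = Gcd ((\<lambda>x. x - a) ` A \<union> (\<lambda>x. x - b) ` B)"
  have dA: "d dvd x - a" if "x \<in> A" for x unfolding d_def using that by (intro Gcd_dvd) auto
  have dB: "d dvd x - b" if "x \<in> B" for x unfolding d_def using that by (intro Gcd_dvd) auto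
  have "d \<noteq> 0"
  proof
    assume "d = 0"
    then have "x = a" if "x \<in> A" for x using dA[OF that] by simp
    moreover have "x = b" if "x \<in> B" for x using dB[OF that] \<open>d = 0\<close> by simp
    ultimately have "A = {a}" "B = {b}" using ab by blast+
    then show False using small by (simp add: set_plus_def)
  qed
  moreover have "d \<ge> 0" by (simp add: d_def)
  ultimately have d: "d > 0" by simp
  define A' where "A' = (\<lambda>x. (x - a) div d) ` A"
  define B' where "B' = (\<lambda>x. (x - b) div d) ` B"
  have A_eq: "A = (\<lambda>x. a + x * d) ` A'"
    using dA by (force simp: A'_def image_image)
  have B_eq: "B = (\<lambda>x. b + x * d) ` B'"
    using dB by (force simp: B'_def image_image)
  have AB_eq: "A + B = (\<lambda>x. a + b + x * d) ` (A' + B')"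
  proof (intro equalityI subsetI)
    fix s assume "s \<in> A + B"
    then obtain x y where "x \<in> A" "y \<in> B" "s = x + y" by (rule set_plus_elim)
    then obtain x' y' where xy: "x' \<in> A'" "y' \<in> B'" "s = (a + x' * d) + (b + y' * d)"
      using A_eq B_eq by blast
    then have "s = a + b + (x' + y') * d" by (simp add: algebra_simps)
    then show "s \<in> (\<lambda>x. a + b + x * d) ` (A' + B')" using xy by blast
  next
    fix s assume "s \<in> (\<lambda>x. a + b + x * d) ` (A' + B')"
    then obtain x where x: "x \<in> A' + B'" "s = a + b + x * d" by auto
    from x(1) obtain x' y' where xy: "x' \<in> A'" "y' \<in> B'" "x = x' + y'" by (rule set_plus_elim)
    then have "s = (a + x' * d) + (b + y' * d)" using x by (simp add: algebra_simps)
    moreover have "a + x' * d \<in> A" "b + y' * d \<in> B" using A_eq B_eq xy by blast+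
    ultimately show "s \<in> A + B" by (simp add: set_plus_intro)
  qed
  have inj: "inj_on (\<lambda>x. c + x * d) M" for c M using d by (auto simp: inj_on_def)
  have cards: "card A = card A'" "card B = card B'" "card (A + B) = card (A' + B')"
    unfolding AB_eq by (subst A_eq B_eq, simp add: card_image inj)+ (simp add: card_image inj)
  have fin': "finite A'" "finite B'" using fin by (auto simp: A'_def B'_def)
  have zero: "0 \<in> A'" "0 \<in> B'" using ab by (auto simp: A'_def B'_def intro: image_eqI[rotated])
  have nonneg: "x \<ge> 0" if "x \<in> A' \<union> B'" for x
    using that ab_le b_le d by (auto simp: A'_def B'_def pos_imp_zdiv_nonneg_iff)
  have "(\<exists>c. {c..<c + int (card A' + card B') - 1} \<subseteq> A' + B') \<and>
    Max A' + int (card B') \<le> int (card (A' + B')) \<and> Max B' + int (card A') \<le> int (card (A' + B'))"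
  proof (rule small_sumset_normalized)
    show "A' \<subseteq> {0..Max A'}" "B' \<subseteq> {0..Max B'}" using fin' nonneg by auto
    show "Max A' \<in> A'" "Max B' \<in> B'" using fin' zero by (auto intro: Max_in)
    fix e assume e: "\<And>x. x \<in> A' \<union> B' \<Longrightarrow> e dvd x"
    have "e * d dvd y" if "y \<in> (\<lambda>x. x - a) ` A \<union> (\<lambda>x. x - b) ` B" for y
    proof -
      have "d dvd y" using that dA dB by auto
      moreover have "e dvd y div d" using that by (intro e) (auto simp: A'_def B'_def)
      ultimately show ?thesis by (metis dvd_mult_div_cancel mult.commute mult_dvd_mono dvd_refl)
    qed
    then have "e * d dvd d" unfolding d_def by (intro Gcd_greatest) (auto simp: d_def)
    then show "e dvd 1" using d by simp
  next
    show "card (A' + B') + 3 \<le> card A' + card B' + min (card A') (card B')"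
      using small by (simp only: cards)
    assume eq: "A' = B'"
    have "B = (+) (b - a) ` A" by (subst B_eq, subst A_eq) (simp add: eq image_image algebra_simps)
    then have "card (A + B) + 4 \<le> 3 * card A" by (rule small_translate)
    then show "card (A' + B') + 4 \<le> 3 * card A'" by (simp only: cards)
  qed (use zero in auto)
  then obtain c where c: "{c..<c + int (card A + card B) - 1} \<subseteq> A' + B'"
    and len: "Max A' + int (card B) \<le> int (card (A + B))" "Max B' + int (card A) \<le> int (card (A + B))"
    by (auto simp only: cards)
  have sub: "(\<lambda>x. y + x * d) ` M \<subseteq> {y + int i * d |i. i < k}"
    if "\<And>x. x \<in> M \<Longrightarrow> 0 \<le> x \<and> x < int k" for M y k
  proof
    fix s assume "s \<in> (\<lambda>x. y + x * d) ` M"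
    then obtain x where "x \<in> M" "s = y + x * d" by auto
    then show "s \<in> {y + int i * d |i. i < k}"
      using that[of x] by (intro CollectI exI[of _ "nat x"]) auto
  qed
  have "A \<subseteq> {a + int i * d |i. i < card (A + B) + 1 - card B}"
  proof (subst (1) A_eq, rule sub)
    fix x assume x: "x \<in> A'"
    then have "x \<le> Max A'" using fin' by simp
    then show "0 \<le> x \<and> x < int (card (A + B) + 1 - card B)" using x nonneg[of x] len by auto
  qed
  moreover have "B \<subseteq> {b + int i * d |i. i < card (A + B) + 1 - card A}"
  proof (subst (1) B_eq, rule sub)
    fix x assume x: "x \<in> B'"
    then have "x \<le> Max B'" using fin' by simp
    then show "0 \<le> x \<and> x < int (card (A + B) + 1 - card A)" using x nonneg[of x] len by auto
  qed
  moreover have "{(a + b + c * d) + int i * d |i. i < card A + card B - 1} \<subseteq> A + B"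
  proof
    fix s assume "s \<in> {(a + b + c * d) + int i * d |i. i < card A + card B - 1}"
    then obtain i where i: "i < card A + card B - 1" "s = a + b + (c + int i) * d"
      by (auto simp: algebra_simps)
    then have "c + int i \<in> A' + B'" using c by auto
    then show "s \<in> A + B" using i(2) AB_eq by auto
  qed
  ultimately show ?thesis by blast
qed

section \<open>Rectification\<close>

text \<open>With the rows given by a function, replacing row \<open>i\<close> is the update
  \<open>r(i := v)\<close>.\<close>

definition rows_mat :: "nat \<Rightarrow> (nat \<Rightarrow> nat \<Rightarrow> 'a) \<Rightarrow> 'a mat" where
  "rows_mat n r = mat n n (\<lambda>(i, j). r i j)"

lemma rows_mat_carrier [simp]: "rows_mat n r \<in> carrier_mat n n"
  and rows_mat_index [simp]: "i < n \<Longrightarrow> j < n \<Longrightarrow> rows_mat n r $$ (i, j) = r i j"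
  and rows_mat_dim [simp]: "dim_row (rows_mat n r) = n" "dim_col (rows_mat n r) = n"
  by (simp_all add: rows_mat_def)

section \<open>Cramer's rule and determinant bounds\<close>

lemma det_rows_mat_upd:
  fixes r :: "nat \<Rightarrow> nat \<Rightarrow> 'a::comm_ring_1"
  assumes "i < n"
  shows "det (rows_mat n (r(i := v))) = (\<Sum>j<n. v j * cofactor (rows_mat n r) i j)"
proof -
  have "mat_delete (rows_mat n (r(i := v))) i j = mat_delete (rows_mat n r) i j" for j
    using assms by (intro eq_matI) (auto simp: mat_delete_def rows_mat_def)
  then have "cofactor (rows_mat n (r(i := v))) i j = cofactor (rows_mat n r) i j" for j
    by (simp add: cofactor_def)
  then show ?thesis
    using laplace_expansion_row[OF rows_mat_carrier assms, of "r(i := v)"] assms by simp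
qed

lemma sum_row_cofactor:
  fixes r :: "nat \<Rightarrow> nat \<Rightarrow> 'a::comm_ring_1"
  assumes "i < n" "k < n"
  shows "(\<Sum>j<n. r i j * cofactor (rows_mat n r) k j) = (if i = k then det (rows_mat n r) else 0)"
proof -
  have "(rows_mat n r * adj_mat (rows_mat n r)) $$ (i, k) = (det (rows_mat n r) \<cdot>\<^sub>m 1\<^sub>m n) $$ (i, k)"
    by (simp add: adj_mat(2)[OF rows_mat_carrier])
  then show ?thesis
    using assms adj_mat(1)[OF rows_mat_carrier, of n r]
    by (auto simp: scalar_prod_def adj_mat_def atLeast0LessThan)
qed

lemma sum_column_cofactor:
  fixes r :: "nat \<Rightarrow> nat \<Rightarrow> 'a::comm_ring_1"
  assumes "j < n" "k < n"
  shows "(\<Sum>i<n. cofactor (rows_mat n r) i j * r i k) = (if j = k then det (rows_mat n r) else 0)"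
proof -
  have "(adj_mat (rows_mat n r) * rows_mat n r) $$ (j, k) = (det (rows_mat n r) \<cdot>\<^sub>m 1\<^sub>m n) $$ (j, k)"
    by (simp add: adj_mat(3)[OF rows_mat_carrier])
  then show ?thesis
    using assms adj_mat(1)[OF rows_mat_carrier, of n r]
    by (auto simp: scalar_prod_def adj_mat_def atLeast0LessThan)
qed

text \<open>Cramer's rule without division: the adjugate is applied to the product of the matrix
  with \<open>x\<close>.\<close>

lemma det_mult_coordinate:
  fixes r :: "nat \<Rightarrow> nat \<Rightarrow> 'a::comm_ring_1"
  assumes "j < n"
  shows "det (rows_mat n r) * x j = (\<Sum>i<n. cofactor (rows_mat n r) i j * (\<Sum>k<n. r i k * x k))"
proof -
  have "(\<Sum>i<n. cofactor (rows_mat n r) i j * (\<Sum>k<n. r i k * x k))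
      = (\<Sum>k<n. (\<Sum>i<n. cofactor (rows_mat n r) i j * r i k) * x k)"
    unfolding sum_distrib_left sum_distrib_right mult.assoc by (rule sum.swap)
  also have "\<dots> = (\<Sum>k<n. if j = k then det (rows_mat n r) * x k else 0)"
    using assms by (intro sum.cong) (auto simp: sum_column_cofactor)
  also have "\<dots> = det (rows_mat n r) * x j" using assms by simp
  finally show ?thesis by simp
qed

text \<open>Cramer's rule for writing \<open>v\<close> in terms of the rows, evaluated at
  \<open>x\<close>; a form can then be shown to vanish term by term.\<close>

lemma det_mult_linear_form:
  fixes r :: "nat \<Rightarrow> nat \<Rightarrow> 'a::comm_ring_1"
  shows "det (rows_mat n r) * (\<Sum>j<n. v j * x j)
    = (\<Sum>i<n. det (rows_mat n (r(i := v))) * (\<Sum>k<n. r i k * x k))"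
proof -
  have "det (rows_mat n r) * (\<Sum>j<n. v j * x j) = (\<Sum>j<n. v j * (det (rows_mat n r) * x j))"
    by (simp add: sum_distrib_left mult.left_commute)
  also have "\<dots> = (\<Sum>j<n. v j * (\<Sum>i<n. cofactor (rows_mat n r) i j * (\<Sum>k<n. r i k * x k)))"
    by (intro sum.cong refl) (simp add: det_mult_coordinate)
  also have "\<dots> = (\<Sum>i<n. (\<Sum>j<n. v j * cofactor (rows_mat n r) i j) * (\<Sum>k<n. r i k * x k))"
    unfolding sum_distrib_left[of "v _"] sum_distrib_right mult.assoc by (rule sum.swap)
  also have "\<dots> = (\<Sum>i<n. det (rows_mat n (r(i := v))) * (\<Sum>k<n. r i k * x k))"
    by (intro sum.cong refl) (simp add: det_rows_mat_upd)
  finally show ?thesis .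
qed

lemma det_rows_mat_zero_sums:
  fixes r :: "nat \<Rightarrow> nat \<Rightarrow> 'a::comm_ring_1"
  assumes "n > 0" "\<And>i. i < n \<Longrightarrow> (\<Sum>j<n. r i j) = 0"
  shows "det (rows_mat n r) = 0"
  using det_mult_coordinate[OF assms(1), of r "\<lambda>_. 1"] assms(2) by simp

text \<open>
  Taking \<open>x \<ge> n\<close> or \<open>y \<ge> n\<close> below gives the rows with at most one nonzero entry, so that the class is
  closed under deleting a column.
\<close>

definition edge_row :: "nat \<Rightarrow> (nat \<Rightarrow> int) \<Rightarrow> bool" where
  "edge_row n v \<longleftrightarrow> (\<exists>x y. \<forall>j<n. v j = of_bool (j = x) - of_bool (j = y))"

lemma edge_row_delete:
  assumes "edge_row (Suc n) v"
  shows "edge_row n (\<lambda>j. v (if j < c then j else Suc j))"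
proof -
  obtain x y where v: "\<And>j. j < Suc n \<Longrightarrow> v j = of_bool (j = x) - of_bool (j = y)"
    using assms by (auto simp: edge_row_def)
  \<comment> \<open>Renumbers the columns after deletion of \<open>c\<close>; an endpoint at
    \<open>c\<close> itself moves to the out-of-range index \<open>n\<close>.\<close>
  define d where "d = (\<lambda>z::nat. if z < c then z else if z = c then n else z - 1)"
  have "(if j < c then j else Suc j) = z \<longleftrightarrow> j = d z" if "j < n" for j z
    using that by (auto simp: d_def)
  then have "v (if j < c then j else Suc j) = of_bool (j = d x) - of_bool (j = d y)" if "j < n" for j
    using that by (subst v) auto
  then show ?thesis unfolding edge_row_def by blast
qed

text \<open>Total unimodularity of directed incidence matrices: either all rows sum to zero and the
  determinant vanishes, or some row has a single entry \<open>1\<close> or \<open>-1\<close>, and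
  expansion along it leaves a smaller matrix of the same kind.\<close>

lemma abs_det_edge_rows_le_1:
  assumes "\<And>i. i < n \<Longrightarrow> edge_row n (r i)"
  shows "\<bar>det (rows_mat n r)\<bar> \<le> 1"
  using assms
proof (induction n arbitrary: r)
  case 0
  then show ?case by simp
next
  case (Suc n)
  show ?case
  proof (cases "\<forall>i<Suc n. (\<Sum>j<Suc n. r i j) = 0")
    case True
    then show ?thesis by (subst det_rows_mat_zero_sums) auto
  next
    case False
    then obtain i where i: "i < Suc n" "(\<Sum>j<Suc n. r i j) \<noteq> 0" by blast
    obtain x y where xy: "\<And>j. j < Suc n \<Longrightarrow> r i j = of_bool (j = x) - of_bool (j = y)"
      using Suc.prems[OF i(1)] by (auto simp: edge_row_def)
    have "(\<Sum>j<Suc n. r i j) = (\<Sum>j<Suc n. of_bool (j = x)) - (\<Sum>j<Suc n. of_bool (j = y))"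
      unfolding sum_subtractf[symmetric] using xy by (intro sum.cong) auto
    also have "\<dots> = of_bool (x < Suc n) - of_bool (y < Suc n)"
      by (simp add: of_bool_def sum.delta del: sum.lessThan_Suc)
    finally have "x < Suc n \<and> \<not> y < Suc n \<or> \<not> x < Suc n \<and> y < Suc n"
      using i(2) by (auto split: if_splits)
    then obtain c e where c: "c < Suc n" "\<bar>e\<bar> = 1" "\<And>j. j < Suc n \<Longrightarrow> r i j = (if j = c then e else 0)"
    proof
      assume "x < Suc n \<and> \<not> y < Suc n"
      then show ?thesis using xy by (intro that[of x 1]) auto
    next
      assume "\<not> x < Suc n \<and> y < Suc n"
      then show ?thesis using xy by (intro that[of y "- 1"]) auto
    qed
    have "det (rows_mat (Suc n) r) = (\<Sum>j<Suc n. rows_mat (Suc n) r $$ (i, j) * cofactor (rows_mat (Suc n) r) i j)"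
      using i by (intro laplace_expansion_row) auto
    also have "\<dots> = (\<Sum>j<Suc n. if j = c then e * cofactor (rows_mat (Suc n) r) i j else 0)"
      using i c by (intro sum.cong) auto
    also have "\<dots> = e * cofactor (rows_mat (Suc n) r) i c"
      using c by (simp del: sum.lessThan_Suc)
    finally have "\<bar>det (rows_mat (Suc n) r)\<bar> = \<bar>det (mat_delete (rows_mat (Suc n) r) i c)\<bar>"
      using c(2) by (simp add: abs_mult cofactor_def power_abs)
    also have "mat_delete (rows_mat (Suc n) r) i c
        = rows_mat n (\<lambda>i' j'. r (if i' < i then i' else Suc i') (if j' < c then j' else Suc j'))"
      by (intro eq_matI) (auto simp: mat_delete_def rows_mat_def)
    also have "\<bar>det \<dots>\<bar> \<le> 1"
      using Suc.prems by (intro Suc.IH edge_row_delete) auto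
    finally show ?thesis .
  qed
qed

text \<open>By linearity in one row of \<open>K\<close>, the determinant is a sum of two
  determinants with one exceptional row fewer.\<close>

lemma abs_det_le_power_2:
  assumes "finite K" "K \<subseteq> {..<n}"
    and "\<And>i. i < n \<Longrightarrow> i \<notin> K \<Longrightarrow> edge_row n (r i)"
    and "\<And>i. i \<in> K \<Longrightarrow> \<exists>u v. edge_row n u \<and> edge_row n v \<and> (\<forall>j<n. r i j = u j + v j)"
  shows "\<bar>det (rows_mat n r)\<bar> \<le> 2 ^ card K"
  using assms
proof (induction K arbitrary: r rule: finite_induct)
  case empty
  then show ?case using abs_det_edge_rows_le_1[of n r] by auto
next
  case (insert k K)
  obtain u v where uv: "edge_row n u" "edge_row n v" "\<And>j. j < n \<Longrightarrow> r k j = u j + v j"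
    using insert.prems(3)[of k] by auto
  have k: "k < n" using insert.prems(1) by simp
  have le: "\<bar>det (rows_mat n (r(k := w)))\<bar> \<le> 2 ^ card K" if "edge_row n w" for w
    using insert.prems insert.hyps that by (intro insert.IH) auto
  have "det (rows_mat n r) = det (rows_mat n (r(k := r k)))" by simp
  also have "\<dots> = (\<Sum>j<n. r k j * cofactor (rows_mat n r) k j)" by (rule det_rows_mat_upd[OF k])
  also have "\<dots> = (\<Sum>j<n. u j * cofactor (rows_mat n r) k j + v j * cofactor (rows_mat n r) k j)"
    by (intro sum.cong) (auto simp: uv(3) distrib_right)
  also have "\<dots> = det (rows_mat n (r(k := u))) + det (rows_mat n (r(k := v)))"
    by (simp add: det_rows_mat_upd[OF k] sum.distrib)
  finally have "\<bar>det (rows_mat n r)\<bar> \<le> 2 ^ card K + 2 ^ card K"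
    using le[OF uv(1)] le[OF uv(2)] by linarith
  then show ?case using insert.hyps by simp
qed

text \<open>
  Among the nonsingular matrices whose rows are relations \<open>a + b = c + d\<close> or unit vectors, take one with
  as many relation rows as possible. By Cramer's rule every relation is then a combination of the
  relation rows of this matrix, whose determinant is nonzero and at most \<open>2 ^ (n - 1)\<close>, hence invertible modulo \<open>p\<close>.
  So the values prescribed modulo \<open>p\<close> on the unit rows extend to an integer solution of all
  relations.
\<close>

lemma exists_lift_of_relations:
  fixes s :: "nat \<Rightarrow> int"
  assumes p: "prime p" and n: "n > 0" "2 ^ (n - 1) < p"
  shows "\<exists>x. (\<forall>j<n. [x j = s j] (mod p)) \<and>
    (\<forall>a<n. \<forall>b<n. \<forall>c<n. \<forall>d<n. [s a + s b = s c + s d] (mod p) \<longrightarrow> x a + x b = x c + x d)"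
proof -
  define rel_row where "rel_row = (\<lambda>(a, b, c, d) (j :: nat). of_bool (j = a) + of_bool (j = b) - of_bool (j = c) - of_bool (j = d) :: int)"
  define Q where "Q = {(a, b, c, d). a < n \<and> b < n \<and> c < n \<and> d < n \<and> [s a + s b = s c + s d] (mod p)}"
  have rel_row_prod: "(\<Sum>j<n. rel_row (a, b, c, d) j * y j) = y a + y b - y c - y d"
    if "a < n" "b < n" "c < n" "d < n" for a b c d and y :: "nat \<Rightarrow> int"
  proof -
    have "(\<Sum>j<n. rel_row (a, b, c, d) j * y j)
        = (\<Sum>j<n. (if j = a then y j else 0) + (if j = b then y j else 0)
            - (if j = c then y j else 0) - (if j = d then y j else 0))"
      by (intro sum.cong) (auto simp: rel_row_def)
    then show ?thesis using that by (simp add: sum.distrib sum_subtractf)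
  qed
  define P where "P = (\<lambda>k. \<exists>r K. K \<subseteq> {..<n} \<and> card K = k \<and> (\<forall>i\<in>K. r i \<in> rel_row ` Q) \<and>
    (\<forall>i<n. i \<notin> K \<longrightarrow> (\<exists>x. r i = (\<lambda>j. of_bool (j = x)))) \<and> det (rows_mat n r) \<noteq> 0)"
  have "P 0"
  proof -
    have "rows_mat n (\<lambda>i j. of_bool (j = i)) = (1\<^sub>m n :: int mat)"
      by (intro eq_matI) (auto simp: rows_mat_def)
    then have "det (rows_mat n (\<lambda>i j. of_bool (j = i) :: int)) \<noteq> 0" by simp
    then show ?thesis unfolding P_def by (intro exI[of _ "\<lambda>i j. of_bool (j = i)"] exI[of _ "{}"]) auto
  qed
  moreover have Pn: "k \<le> n" if "P k" for k
    using that card_mono[of "{..<n}"] by (force simp: P_def)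
  ultimately have "P (Greatest P)" by (rule GreatestI_nat) auto
  then obtain r K where K: "K \<subseteq> {..<n}" "card K = Greatest P" "\<And>i. i \<in> K \<Longrightarrow> r i \<in> rel_row ` Q"
    and unit: "\<And>i. i < n \<Longrightarrow> i \<notin> K \<Longrightarrow> \<exists>x. r i = (\<lambda>j. of_bool (j = x))"
    and D0: "det (rows_mat n r) \<noteq> 0"
    unfolding P_def by blast
  define D where "D = det (rows_mat n r)"
  have fK: "finite K" using K finite_subset by blast
  have maximal: "det (rows_mat n (r(i := v))) = 0" if i: "i < n" "i \<notin> K" and v: "v \<in> rel_row ` Q" for i v
  proof (rule ccontr)
    assume "det (rows_mat n (r(i := v))) \<noteq> 0"
    then have "P (card (insert i K))"
      unfolding P_def using K unit i v
      by (intro exI[of _ "r(i := v)"] exI[of _ "insert i K"]) auto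
    then have "card (insert i K) \<le> Greatest P" using Pn by (intro Greatest_le_nat) auto
    then show False using fK i K by simp
  qed
  \<comment> \<open>The entries of a relation row sum to zero, so such rows cannot fill a
    nonsingular matrix. This saves the last factor 2.\<close>
  have "K \<noteq> {..<n}"
  proof
    assume "K = {..<n}"
    then have "(\<Sum>j<n. r i j) = 0" if "i < n" for i
      using K(3)[of i] that rel_row_prod[where y = "\<lambda>_. 1"] by (auto simp: Q_def)
    then show False using D0 n det_rows_mat_zero_sums by blast
  qed
  then have "card K < n" using K psubset_card_mono[of "{..<n}" K] by auto
  then have "card K \<le> n - 1" by simp
  moreover have "\<bar>D\<bar> \<le> 2 ^ card K"
    unfolding D_def
  proof (rule abs_det_le_power_2[OF fK K(1)])
    fix i assume "i < n" "i \<notin> K"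
    then obtain x where "r i = (\<lambda>j. of_bool (j = x))" using unit by blast
    then show "edge_row n (r i)" unfolding edge_row_def by (intro exI[of _ x] exI[of _ n]) auto
  next
    fix i assume "i \<in> K"
    then obtain a b c d where "r i = rel_row (a, b, c, d)" using K(3) by (metis imageE prod_cases4)
    then have "\<forall>j<n. r i j = (of_bool (j = a) - of_bool (j = c)) + (of_bool (j = b) - of_bool (j = d))"
      by (simp add: rel_row_def)
    moreover have "edge_row n (\<lambda>j. of_bool (j = x) - of_bool (j = y))" for x y
      unfolding edge_row_def by (intro exI[of _ x] exI[of _ y]) simp
    ultimately show "\<exists>u v. edge_row n u \<and> edge_row n v \<and> (\<forall>j<n. r i j = u j + v j)"
      by (intro exI[of _ "\<lambda>j. of_bool (j = a) - of_bool (j = c)"]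
          exI[of _ "\<lambda>j. of_bool (j = b) - of_bool (j = d)"] conjI)
  qed
  ultimately have "\<bar>D\<bar> \<le> 2 ^ (n - 1)"
    using power_increasing[of "card K" "n - 1" "2 :: int"] by linarith
  then have "\<bar>D\<bar> < p" using n by simp
  then have "\<not> p dvd D" using D0 zdvd_not_zless[of "\<bar>D\<bar>" p] by (auto simp: D_def)
  then have "coprime p D" by (rule prime_imp_coprime[OF p])
  then have "coprime D p" by (rule coprime_imp_coprime) auto
  from cong_solve_coprime_int[OF this] obtain u where u: "[D * u = 1] (mod p)" by auto
  \<comment> \<open>Modulo \<open>p\<close> this is the product of the rows with \<open>s\<close>,
    but on relation rows it is exactly zero. As \<open>u\<close> inverts \<open>D\<close> modulo
    \<open>p\<close>, the vector \<open>x\<close> is an integer substitute for the solution of the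
    system with right-hand side \<open>b\<close>.\<close>
  define b where "b = (\<lambda>i. if i \<in> K then 0 else \<Sum>k<n. r i k * s k)"
  define x where "x = (\<lambda>j. u * (\<Sum>i<n. cofactor (rows_mat n r) i j * b i))"
  have rx: "(\<Sum>k<n. r i k * x k) = u * D * b i" if "i < n" for i
  proof -
    have "(\<Sum>k<n. r i k * x k) = u * (\<Sum>k<n. \<Sum>h<n. r i k * (cofactor (rows_mat n r) h k * b h))"
      unfolding x_def sum_distrib_left by (intro sum.cong refl) (rule mult.left_commute)
    also have "(\<Sum>k<n. \<Sum>h<n. r i k * (cofactor (rows_mat n r) h k * b h))
        = (\<Sum>h<n. (\<Sum>k<n. r i k * cofactor (rows_mat n r) h k) * b h)"
      unfolding sum_distrib_right mult.assoc by (rule sum.swap)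
    also have "\<dots> = (\<Sum>h<n. if i = h then D * b h else 0)"
      using that by (intro sum.cong) (auto simp: sum_row_cofactor D_def)
    also have "\<dots> = D * b i" using that by simp
    finally show ?thesis by simp
  qed
  have "[x j = s j] (mod p)" if "j < n" for j
  proof -
    have "[b i = (\<Sum>k<n. r i k * s k)] (mod p)" if "i < n" for i
    proof (cases "i \<in> K")
      case True
      then obtain a b' c d where "(a, b', c, d) \<in> Q" "r i = rel_row (a, b', c, d)"
        using K(3) by (metis imageE prod_cases4)
      then have "[s a + s b' = s c + s d] (mod p)" "(\<Sum>k<n. r i k * s k) = (s a + s b') - (s c + s d)"
        using rel_row_prod[where y = s] by (auto simp: Q_def)
      then show ?thesis using True by (simp add: b_def cong_iff_dvd_diff dvd_diff_commute)
    qed (simp add: b_def)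
    then have "[(\<Sum>i<n. cofactor (rows_mat n r) i j * b i)
        = (\<Sum>i<n. cofactor (rows_mat n r) i j * (\<Sum>k<n. r i k * s k))] (mod p)"
      by (intro cong_sum cong_mult) auto
    then have "[(\<Sum>i<n. cofactor (rows_mat n r) i j * b i) = D * s j] (mod p)"
      using det_mult_coordinate[OF that, of r s] by (simp add: D_def)
    then have "[x j = u * (D * s j)] (mod p)" unfolding x_def by (intro cong_mult) auto
    also have "u * (D * s j) = D * u * s j" by simp
    also have "[D * u * s j = 1 * s j] (mod p)" using u by (intro cong_mult) auto
    finally show ?thesis by simp
  qed
  moreover have "x a + x b' = x c + x d"
    if "a < n" "b' < n" "c < n" "d < n" "[s a + s b' = s c + s d] (mod p)" for a b' c d
  proof -
    have v: "rel_row (a, b', c, d) \<in> rel_row ` Q" using that by (auto simp: Q_def)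
    have "D * (\<Sum>j<n. rel_row (a, b', c, d) j * x j)
        = (\<Sum>i<n. det (rows_mat n (r(i := rel_row (a, b', c, d)))) * (\<Sum>k<n. r i k * x k))"
      unfolding D_def by (rule det_mult_linear_form)
    \<comment> \<open>The terms of relation rows vanish because \<open>b i = 0\<close>, those of
      unit rows by maximality.\<close>
    also have "\<dots> = 0"
    proof (rule sum.neutral, intro ballI)
      fix i assume "i \<in> {..<n}"
      then show "det (rows_mat n (r(i := rel_row (a, b', c, d)))) * (\<Sum>k<n. r i k * x k) = 0"
        using maximal[OF _ _ v, of i] rx[of i] by (cases "i \<in> K") (auto simp: b_def)
    qed
    finally show ?thesis using D0 rel_row_prod[OF that(1-4), of x] by (simp add: D_def)
  qed
  ultimately show ?thesis by blast
qed

theorem exists_rectification: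
  fixes S :: "int set"
  assumes p: "prime p" and S: "finite S" "2 ^ (card S - 1) < p"
  shows "\<exists>f. (\<forall>s\<in>S. [f s = s] (mod p)) \<and>
    (\<forall>a\<in>S. \<forall>b\<in>S. \<forall>c\<in>S. \<forall>d\<in>S. [a + b = c + d] (mod p) \<longrightarrow> f a + f b = f c + f d)"
proof (cases "S = {}")
  case True
  then show ?thesis by simp
next
  case False
  then have "card S > 0" using S by (simp add: card_gt_0_iff)
  obtain h where h: "bij_betw h {..<card S} S"
    using ex_bij_betw_nat_finite[OF S(1)] by (auto simp: atLeast0LessThan)
  obtain x where x: "\<And>j. j < card S \<Longrightarrow> [x j = h j] (mod p)"
    and rel: "\<And>a b c d. \<lbrakk>a < card S; b < card S; c < card S; d < card S; [h a + h b = h c + h d] (mod p)\<rbrakk>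
      \<Longrightarrow> x a + x b = x c + x d"
    using exists_lift_of_relations[OF p \<open>card S > 0\<close> S(2), of h] by blast
  define g where "g = inv_into {..<card S} h"
  have g: "g s < card S" "h (g s) = s" if "s \<in> S" for s
    using that h bij_betw_imp_surj_on[OF h] inv_into_into[of s h "{..<card S}"] f_inv_into_f[of s h "{..<card S}"]
    by (auto simp: g_def)
  show ?thesis
  proof (intro exI[of _ "\<lambda>s. x (g s)"] conjI ballI impI)
    fix s assume "s \<in> S"
    then show "[x (g s) = s] (mod p)" using x[of "g s"] g by simp
  next
    fix a b c d assume "a \<in> S" "b \<in> S" "c \<in> S" "d \<in> S" "[a + b = c + d] (mod p)"
    then show "x (g a) + x (g b) = x (g c) + x (g d)" using g by (intro rel) auto
  qed
qed

section \<open>Progressions modulo a prime\<close>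

lemma (in residues) add_pow_eq:
  assumes "x \<in> carrier R"
  shows "[(i::nat)] \<cdot> x = (int i * x) mod m"
proof (induction i)
  case 0
  then show ?case by (simp add: res_zero_eq)
next
  case (Suc i)
  have "[Suc i] \<cdot> x = [i] \<cdot> x \<oplus> x" by simp
  also have "\<dots> = ((int i * x) mod m + x) mod m" using Suc by (simp add: res_add_eq)
  finally show ?case by (simp add: mod_simps algebra_simps)
qed

lemma (in residues) arith_prog_image:
  assumes "n \<ge> 1"
  shows "arith_prog R (d mod m) ((\<lambda>i. (a + int i * d) mod m) ` {..<n})"
proof -
  have d: "d mod m \<in> carrier R" by (rule mod_in_carrier)
  have "a mod m \<oplus> [i] \<cdot> (d mod m) = (a + int i * d) mod m" for i :: nat
    by (simp add: add_pow_eq[OF d] res_add_eq mod_simps)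
  then have "(\<lambda>i. (a + int i * d) mod m) ` {..<n} = {a mod m \<oplus> [i] \<cdot> (d mod m) |i::nat. i < n}"
    by auto
  then show ?thesis unfolding arith_prog_def using d assms mod_in_carrier by blast
qed

lemma coprime_multiple_mod:
  fixes y c d p :: int
  assumes "coprime d p" "0 \<le> y" "y < p"
  shows "\<exists>j. 0 \<le> j \<and> j < p \<and> y = (c + j * d) mod p"
proof -
  from cong_solve_coprime_int[OF assms(1)] obtain u where u: "[d * u = 1] (mod p)" by auto
  let ?j = "((y - c) * u) mod p"
  have "[c + ?j * d = c + (y - c) * u * d] (mod p)"
    by (intro cong_add cong_mult cong_refl) (simp add: cong_def)
  also have "c + (y - c) * u * d = c + (y - c) * (d * u)" by (simp add: algebra_simps)
  also have "[c + (y - c) * (d * u) = c + (y - c) * 1] (mod p)"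
    using u by (intro cong_add cong_mult) auto
  finally have "y = (c + ?j * d) mod p" using assms by (simp add: cong_def)
  then show ?thesis using assms by (intro exI[of _ ?j]) auto
qed

theorem theorem2p12:
  fixes p :: nat and G :: "int ring" and A B C :: "int set" and r \<delta> :: int
  assumes "prime p"
    and "G = residue_ring (int p)"
    and "A \<subseteq> carrier G" and "B \<subseteq> carrier G"
    and "A \<noteq> {}" and "B \<noteq> {}"
    and "A <+>\<^bsub>G\<^esub> B \<noteq> carrier G"
    and "C = a_set_inv\<^bsub>G\<^esub> (carrier G - (A <+>\<^bsub>G\<^esub> B))"
    and "card A \<ge> card B"
    and "int (card (A \<union> B)) \<le> \<lceil>log 2 (real p)\<rceil>"
    and "int (card (A <+>\<^bsub>G\<^esub> B)) = int (card A) + int (card B) + r"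
    and "\<delta> = (if are_translates G A B then 1 else 0)"
    and "int (card A) + int (card B) + r \<le> int (card A) + 2 * int (card B) - 3 - \<delta>"
  shows "\<exists>d P\<^sub>A P\<^sub>B P\<^sub>C.
           arith_prog G d P\<^sub>A \<and> arith_prog G d P\<^sub>B \<and> arith_prog G d P\<^sub>C \<and>
           A \<subseteq> P\<^sub>A \<and> int (card P\<^sub>A) \<le> int (card A) + r + 1 \<and>
           B \<subseteq> P\<^sub>B \<and> int (card P\<^sub>B) \<le> int (card B) + r + 1 \<and>
           C \<subseteq> P\<^sub>C \<and> int (card P\<^sub>C) \<le> int (card C) + r + 1"
proof -
  define q where "q = int p"
  have q1: "q > 1" using prime_gt_1_nat[OF assms(1)] by (simp add: q_def)
  have pq: "prime q" using assms(1) by (simp add: q_def)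
  interpret residues q G by unfold_locales (use assms(2) q1 in \<open>simp_all add: q_def\<close>)
  have carrier: "carrier G = {0..<q}" by (auto simp: res_carrier_eq)
  have AB: "A \<subseteq> {0..<q}" "B \<subseteq> {0..<q}" using assms(3,4) carrier by auto
  then have fin: "finite A" "finite B" using finite_subset by blast+
  let ?S = "A <+>\<^bsub>G\<^esub> B"
  have S: "?S = {(a + b) mod q |a b. a \<in> A \<and> b \<in> B}"
    by (auto simp: set_add_def' res_add_eq)
  have "2 ^ (card (A \<union> B) - 1) < q"
  proof -
    have "real_of_int (int (card (A \<union> B))) - 1 < log 2 (real p)"
      using assms(10) by (simp add: le_ceiling_iff)
    moreover have "card (A \<union> B) \<ge> 1"
      using assms(5) fin by (simp add: Suc_le_eq card_gt_0_iff)
    ultimately have "real (card (A \<union> B) - 1) < log 2 (real p)" by (simp add: of_nat_diff)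
    then have "2 powr real (card (A \<union> B) - 1) < real p"
      using q1 by (simp add: less_log_iff q_def)
    then have "real (2 ^ (card (A \<union> B) - 1)) < real p" by (simp add: powr_realpow)
    then have "2 ^ (card (A \<union> B) - 1) < p" by linarith
    then have "int (2 ^ (card (A \<union> B) - 1)) < int p" by linarith
    then show ?thesis by (simp add: q_def)
  qed
  then obtain f where f: "\<And>s. s \<in> A \<union> B \<Longrightarrow> [f s = s] (mod q)"
    and rel: "\<And>a b c d. \<lbrakk>a \<in> A \<union> B; b \<in> A \<union> B; c \<in> A \<union> B; d \<in> A \<union> B; [a + b = c + d] (mod q)\<rbrakk>
      \<Longrightarrow> f a + f b = f c + f d"
    using exists_rectification[OF pq, of "A \<union> B"] fin by blast
  have f_mod: "f s mod q = s" if "s \<in> A \<union> B" for s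
    using f[OF that] that AB by (auto simp: cong_def)
  have inj_f: "inj_on f (A \<union> B)" by (rule inj_on_inverseI[of _ "\<lambda>x. x mod q"]) (rule f_mod)
  define A' where "A' = f ` A"
  define B' where "B' = f ` B"
  have cA: "card A' = card A" and cB: "card B' = card B"
    unfolding A'_def B'_def using inj_f by (auto intro!: card_image elim: inj_on_subset)
  have fin': "finite A'" "finite B'" and ne': "A' \<noteq> {}" "B' \<noteq> {}"
    using fin assms(5,6) by (auto simp: A'_def B'_def)
  have S_eq: "?S = (\<lambda>s. s mod q) ` (A' + B')"
  proof -
    have fab: "(f a + f b) mod q = (a + b) mod q" if "a \<in> A" "b \<in> B" for a b
      using cong_add[OF f f, of a b] that by (auto simp: cong_def)
    show ?thesis
    proof (intro equalityI subsetI)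
      fix s assume "s \<in> ?S"
      then obtain a b where ab: "a \<in> A" "b \<in> B" "s = (a + b) mod q" unfolding S by blast
      then have "f a + f b \<in> A' + B'" by (auto simp: A'_def B'_def intro: set_plus_intro)
      then show "s \<in> (\<lambda>s. s mod q) ` (A' + B')" using fab[OF ab(1,2)] ab(3) by (intro image_eqI) auto
    next
      fix s assume "s \<in> (\<lambda>s. s mod q) ` (A' + B')"
      then obtain t where t: "t \<in> A' + B'" "s = t mod q" by auto
      from t(1) obtain x y where "x \<in> A'" "y \<in> B'" "t = x + y" by (rule set_plus_elim)
      then obtain a b where "a \<in> A" "b \<in> B" "t = f a + f b" by (auto simp: A'_def B'_def)
      then show "s \<in> ?S" unfolding S using fab t(2) by auto
    qed
  qed
  \<comment> \<open>Congruent sums have equal lifts by \<open>rel\<close>, so lifting preserves the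
    size of the sumset.\<close>
  have inj_S: "inj_on (\<lambda>s. s mod q) (A' + B')"
  proof (rule inj_onI)
    fix s t assume s: "s \<in> A' + B'" and t: "t \<in> A' + B'" and st: "s mod q = t mod q"
    from s obtain x y where "x \<in> A'" "y \<in> B'" "s = x + y" by (rule set_plus_elim)
    then obtain a b where ab: "a \<in> A" "b \<in> B" "s = f a + f b" by (auto simp: A'_def B'_def)
    from t obtain x y where "x \<in> A'" "y \<in> B'" "t = x + y" by (rule set_plus_elim)
    then obtain c d where cd: "c \<in> A" "d \<in> B" "t = f c + f d" by (auto simp: A'_def B'_def)
    have "[a + b = f a + f b] (mod q)" using f ab by (intro cong_add) (auto simp: cong_sym_eq)
    also have "[f a + f b = f c + f d] (mod q)" using st ab cd by (simp add: cong_def)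
    also have "[f c + f d = c + d] (mod q)" using f cd by (intro cong_add) auto
    finally show "s = t" using rel[of a b c d] ab cd by auto
  qed
  define N where "N = card ?S"
  have N': "card (A' + B') = N" unfolding N_def S_eq using inj_S by (simp add: card_image)
  have Nr: "int N = int (card A) + int (card B) + r" using assms(11) by (simp add: N_def)
  have small: "card (A' + B') + 3 \<le> card A' + card B' + min (card A') (card B')"
    using assms(9,12,13) Nr by (auto simp: N' cA cB split: if_splits)
  \<comment> \<open>A translation between the lifts reduces to one between \<open>A\<close> and
    \<open>B\<close>, so \<open>\<delta> = 1\<close> supplies the extra unit.\<close>
  have small_translate: "card (A' + B') + 4 \<le> 3 * card A'" if t: "B' = (+) t ` A'" for t
  proof -
    have "B = (\<lambda>b. f b mod q) ` B" using f_mod by (auto simp: image_iff)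
    also have "\<dots> = (\<lambda>x. x mod q) ` B'" by (simp add: B'_def image_image)
    also have "\<dots> = (\<lambda>a. (t + f a) mod q) ` A" by (simp add: t A'_def image_image)
    also have "\<dots> = (\<lambda>a. (a + t mod q) mod q) ` A"
    proof (rule image_cong)
      fix a assume "a \<in> A"
      then have "(t + f a) mod q = (t + f a mod q) mod q" by (simp add: mod_simps)
      then show "(t + f a) mod q = (a + t mod q) mod q"
        using f_mod[of a] \<open>a \<in> A\<close> by (simp add: mod_simps add.commute)
    qed simp
    also have "\<dots> = A +>\<^bsub>G\<^esub> (t mod q)" by (auto simp: a_r_coset_def' res_add_eq)
    finally have "are_translates G A B"
      unfolding are_translates_def using mod_in_carrier by blast
    moreover have "card A = card B" using t cA cB card_translate[of t A'] by simp
    ultimately show ?thesis using assms(12,13) Nr by (simp add: N' cA)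
  qed
  have "\<exists>a b c d. A' \<subseteq> {a + int i * d |i. i < card (A' + B') + 1 - card B'} \<and>
    B' \<subseteq> {b + int i * d |i. i < card (A' + B') + 1 - card A'} \<and>
    {c + int i * d |i. i < card A' + card B' - 1} \<subseteq> A' + B'"
    by (rule small_sumset_int[OF fin' ne' small]) (rule small_translate)
  then obtain a b c d where PA: "A' \<subseteq> {a + int i * d |i. i < N + 1 - card B}"
    and PB: "B' \<subseteq> {b + int i * d |i. i < N + 1 - card A}"
    and PS: "{c + int i * d |i. i < card A + card B - 1} \<subseteq> A' + B'"
    unfolding cA cB N' by blast
  have N_ge: "card A + card B \<le> N + 1" using card_sumset_ge[OF fin' ne'] by (simp add: cA cB N')
  have S_sub: "?S \<subset> carrier G" using S assms(7) q1 by (auto simp: carrier)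
  then have Nq: "int N < q" unfolding N_def using psubset_card_mono[OF finite, of ?S] carrier q1 by auto
  have card_pos: "card A \<ge> 1" "card B \<ge> 1"
    using assms(5,6) fin by (simp_all add: Suc_le_eq card_gt_0_iff)
  define n where "n = card A + card B - 1"
  have n: "1 \<le> n" "n \<le> N" "int n = int N - r - 1"
    using N_ge Nr card_pos by (auto simp: n_def)
  \<comment> \<open>Otherwise \<open>A\<close> would reduce to a single point, and \<open>B\<close>
    with \<open>|B| \<le> |A|\<close> as well, which \<open>small\<close> excludes.\<close>
  have "\<not> q dvd d"
  proof
    assume "q dvd d"
    have "x = a mod q" if "x \<in> A" for x
    proof -
      have "f x \<in> A'" using that by (simp add: A'_def)
      then obtain i :: nat where "f x = a + int i * d" using PA by auto
      moreover have "(a + int i * d) mod q = a mod q" for i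
        using \<open>q dvd d\<close> by (metis dvd_mult mod_add_right_eq add.right_neutral dvd_imp_mod_0)
      ultimately show ?thesis using f_mod[of x] that by simp
    qed
    then have "A \<subseteq> {a mod q}" by auto
    then have "card A \<le> 1" using card_mono[of "{a mod q}" A] by simp
    then show False using N_ge small assms(9) by (simp add: N' cA cB)
  qed
  then have "coprime q d" by (rule prime_imp_coprime[OF pq])
  then have cop: "coprime d q" by (simp add: coprime_commute)
  let ?prog = "\<lambda>a n. (\<lambda>i. (a + int i * d) mod q) ` {..<n}"
  have card_prog: "card (?prog a n) \<le> n" for a n
    using card_image_le[of "{..<n}"] by force
  have sub_prog: "M \<subseteq> ?prog a k"
    if M: "M \<subseteq> A \<union> B" "f ` M \<subseteq> {a + int i * d |i. i < k}" for M a k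
  proof
    fix x assume x: "x \<in> M"
    then obtain i where "i < k" "f x = a + int i * d" using M(2) by blast
    moreover have "f x mod q = x" using M(1) x by (intro f_mod) auto
    ultimately show "x \<in> ?prog a k" by (intro image_eqI[of _ _ i]) auto
  qed
  have "A \<subseteq> ?prog a (N + 1 - card B)" using PA by (intro sub_prog) (auto simp: A'_def)
  moreover have "B \<subseteq> ?prog b (N + 1 - card A)" using PB by (intro sub_prog) (auto simp: B'_def)
  \<comment> \<open>As \<open>d\<close> is invertible, \<open>c + j * d\<close> with
    \<open>0 \<le> j < q\<close> runs through the whole group, and the first \<open>n\<close> terms
    are sums. The remaining terms are negated and read backwards from \<open>j = q - 1\<close>,
    which restores the difference \<open>d\<close>.\<close>
  moreover have "C \<subseteq> ?prog (- (c + (q - 1) * d)) (p - n)"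
  proof
    fix x assume "x \<in> C"
    then obtain y where y: "y \<in> carrier G" "y \<notin> ?S" "x = \<ominus>\<^bsub>G\<^esub> y"
      unfolding assms(8) A_SET_INV_def' by blast
    obtain j where j: "0 \<le> j" "j < q" "y = (c + j * d) mod q"
      using coprime_multiple_mod[OF cop, of y c] y(1) carrier by auto
    have "int n \<le> j"
    proof (rule ccontr)
      assume "\<not> int n \<le> j"
      then have "nat j < card A + card B - 1" using j by (simp add: n_def)
      then have "c + int (nat j) * d \<in> A' + B'" using PS by blast
      then have "(c + int (nat j) * d) mod q \<in> ?S" unfolding S_eq by (rule imageI)
      then show False using y(2) j by simp
    qed
    define i where "i = nat (q - 1 - j)"
    have i: "int i = q - 1 - j" using j by (simp add: i_def)
    have "i < p - n" using i \<open>int n \<le> j\<close> j by (auto simp: q_def)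
    moreover have "x = (- (c + (q - 1) * d) + int i * d) mod q"
    proof -
      have "x = (- (c + j * d)) mod q" using y j by (simp add: res_neg_eq mod_simps)
      also have "- (c + j * d) = - (c + (q - 1) * d) + int i * d" unfolding i by (simp add: algebra_simps)
      finally show ?thesis .
    qed
    ultimately show "x \<in> ?prog (- (c + (q - 1) * d)) (p - n)" by blast
  qed
  moreover have "int (card C) = q - int N"
  proof -
    have "C = (\<lambda>x. \<ominus>\<^bsub>G\<^esub> x) ` (carrier G - ?S)" unfolding assms(8) A_SET_INV_def' by auto
    moreover have "inj_on (\<lambda>x. \<ominus>\<^bsub>G\<^esub> x) (carrier G - ?S)"
      by (rule inj_on_inverseI[of _ "\<lambda>x. \<ominus>\<^bsub>G\<^esub> x"]) auto
    ultimately have "card C = card (carrier G - ?S)" by (simp add: card_image)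
    also have "\<dots> = card (carrier G) - N"
      unfolding N_def using S_sub finite by (intro card_Diff_subset) (auto intro: finite_subset)
    finally show ?thesis using Nq carrier by (simp add: of_nat_diff)
  qed
  moreover have "N + 1 - card B \<ge> 1" "N + 1 - card A \<ge> 1" "p - n \<ge> 1"
    using N_ge n Nq card_pos by (auto simp: q_def)
  moreover have "int (N + 1 - card B) = int (card A) + r + 1" "int (N + 1 - card A) = int (card B) + r + 1"
    "int (p - n) = q - int N + r + 1"
    using N_ge n Nq Nr by (auto simp: of_nat_diff q_def)
  moreover note card_prog[of a "N + 1 - card B"] card_prog[of b "N + 1 - card A"]
    card_prog[of "- (c + (q - 1) * d)" "p - n"]
  ultimately show ?thesis
    by (intro exI[of _ "d mod q"] exI[of _ "?prog a (N + 1 - card B)"]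
        exI[of _ "?prog b (N + 1 - card A)"] exI[of _ "?prog (- (c + (q - 1) * d)) (p - n)"] conjI
        arith_prog_image) linarith+
qed

end
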